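(* Let $K$ be a pure cubic field with ratio $r_K$. \begin{itemize} \item If $K$ is of Type I, then the shape of $K$ is represented by the point $i\,r_K^{1/3}$, which lies in $\mathcal{F}=\{z=x+iy\in\mathfrak{H}: 0\le x\le 1/2,\ x^2+y^2\ge 1\}$ and on the imaginary axis; in particular the shape of $K$ is rectangular. \item If $K$ is of Type II, then the shape of $K$ is represented by the point $\frac{1+i\,r_K^{1/3}}{3}\in\mathfrak{H}$, which lies on the line segment $\operatorname{Re}(z)=1/3$, $\operatorname{Im}(z)>1/3$; such shapes are parallelograms with no extra symmetry. \end{itemize}
   Context: A pure cubic field is a field $K=\mathbf{Q}(m^{1/3})$ with $m$ a positive integer that is not a cube. Each such field can be written uniquely as $K=\mathbf{Q}((ab^2)^{1/3})$ with $a,b$ relatively prime, squarefree, positive integers with $a>b$; the ratio of $K$ is $r_K:=a/b$. Put $m=ab^2$. The field $K$ is of Type II if $3\nmid m$ and $r_K\equiv\pm1\pmod 9$ (equivalently $m\equiv\pm1\pmod 9$), and of Type I otherwise (equivalently, $3$ is wildly ramified in Type I and tamely ramified in Type II). Shape: for a cubic number field $K$, let $K\otimes_{\mathbf{Q}}\mathbf{R}$ carry the positive definite inner product whose quadratic form is $x\mapsto\sum_{\sigma\in\mathrm{Hom}(K,\mathbf{C})}|\sigma(x)|^2$ (extended from $K$). Let $\mathcal{O}_K^\perp$ be the image of the ring of integers $\mathcal{O}_K$ under the orthogonal projection onto the orthogonal complement of $1$ (i.e. $x\mapsto x-\frac{\langle x,1\rangle}{3}\cdot 1$); it is a rank $2$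 lattice. If $B=(B_{ij})_{i,j\in\{0,1\}}$ is the Gram matrix of a basis of $\mathcal{O}_K^\perp$, its associated point is $z=x+iy\in\mathfrak{H}$ (upper half-plane) with $x=B_{01}/B_{00}$, $y=\sqrt{B_{11}/B_{00}-x^2}$. The group $\mathrm{GL}_2(\mathbf{Z})$ acts on $\mathfrak{H}$ by fractional linear transformations for $\mathrm{SL}_2(\mathbf{Z})$ and by $\begin{pmatrix}0&1\\1&0\end{pmatrix}\cdot z=1/\bar z$; changing the basis changes the point within its $\mathrm{GL}_2(\mathbf{Z})$-orbit. The shape of $K$ is this orbit (equivalently the lattice $\mathcal{O}_K^\perp$ up to scaling, rotations and reflections), and "the shape is represented by $z$" means $z$ lies in this orbit. *)

theory Defs
  imports "HOL-Analysis.Analysis" "HOL-Computational_Algebra.Computational_Algebra"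
begin

section \<open>Pure cubic fields\<close>

definition is_subfield :: "'a::field_char_0 set \<Rightarrow> bool" where
  "is_subfield F \<longleftrightarrow> 0 \<in> F \<and> 1 \<in> F \<and>
     (\<forall>x\<in>F. \<forall>y\<in>F. x + y \<in> F \<and> x - y \<in> F \<and> x * y \<in> F) \<and> (\<forall>x\<in>F. inverse x \<in> F)"

text \<open>A subfield of a field of characteristic 0 contains the rationals, so
  \<open>is_subfield hull {\<theta>}\<close> is the field obtained by adjoining \<open>\<theta>\<close> to the rationals.
  Any cube root of \<open>m\<close> in the ambient field may serve as \<open>\<theta>\<close>; all choices give
  isomorphic fields when \<open>m\<close> is not a cube.\<close>

definition adjoins_cube_root :: "'a::field_char_0 set \<Rightarrow> nat \<Rightarrow> bool" where
  "adjoins_cube_root K m \<longleftrightarrow> (\<exists>\<theta>. \<theta> ^ 3 = of_nat m \<and> K = is_subfield hull {\<theta>})"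

definition pure_cubic_field :: "'a::field_char_0 set \<Rightarrow> bool" where
  "pure_cubic_field K \<longleftrightarrow> (\<exists>m>0. (\<nexists>n. m = n ^ 3) \<and> adjoins_cube_root K m)"

definition is_pure_cubic_pair :: "'a::field_char_0 set \<Rightarrow> nat \<times> nat \<Rightarrow> bool" where
  "is_pure_cubic_pair K = (\<lambda>(a, b). 0 < b \<and> b < a \<and> coprime a b \<and> squarefree a \<and> squarefree b \<and>
     adjoins_cube_root K (a * b ^ 2))"

definition pure_cubic_pair :: "'a::field_char_0 set \<Rightarrow> nat \<times> nat" where
  "pure_cubic_pair K = (THE p. is_pure_cubic_pair K p)"

definition ratio :: "'a::field_char_0 set \<Rightarrow> real" where
  "ratio K = (case pure_cubic_pair K of (a, b) \<Rightarrow> real a / real b)"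

text \<open>If 3 does not divide \<open>a * b ^ 2\<close>, then \<open>b\<close> is a unit modulo 9, and the congruence
  \<open>a / b \<equiv> \<plusminus> 1\<close> modulo 9 means \<open>a \<equiv> \<plusminus> b\<close> modulo 9.\<close>

definition type_II :: "'a::field_char_0 set \<Rightarrow> bool" where
  "type_II K \<longleftrightarrow> (case pure_cubic_pair K of (a, b) \<Rightarrow>
     \<not> 3 dvd a * b ^ 2 \<and> (int a mod 9 = int b mod 9 \<or> int a mod 9 = (- int b) mod 9))"

definition type_I :: "'a::field_char_0 set \<Rightarrow> bool" where
  "type_I K \<longleftrightarrow> \<not> type_II K"

definition ring_of_integers :: "'a::field_char_0 set \<Rightarrow> 'a set" where
  "ring_of_integers K = {x \<in> K. algebraic_int x}"


section \<open>The lattice attached to the ring of integers\<close>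

text \<open>Embeddings are taken to be undefined outside \<open>K\<close>, so that each of them occurs
  exactly once.\<close>

definition embeddings :: "'a::field_char_0 set \<Rightarrow> ('a \<Rightarrow> complex) set" where
  "embeddings K = {\<sigma> \<in> extensional K. \<sigma> 1 = 1 \<and>
     (\<forall>x\<in>K. \<forall>y\<in>K. \<sigma> (x + y) = \<sigma> x + \<sigma> y \<and> \<sigma> (x * y) = \<sigma> x * \<sigma> y)}"

text \<open>The real tensor product of a number field \<open>K\<close> is realised as the real span of the image of
  \<open>K\<close> in the space of complex functions on the set of embeddings: \<open>x \<otimes> t\<close> corresponds to
  \<open>\<sigma> \<mapsto> t * \<sigma> x\<close>. On this span \<open>minkowski_inner K\<close> is the real inner product with quadratic form
  \<open>\<Sum>\<sigma>. \<bar>v \<sigma>\<bar>\<^sup>2\<close>. Vectors are 0 outside \<open>embeddings K\<close>.\<close>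

type_synonym 'a minkowski = "('a \<Rightarrow> complex) \<Rightarrow> complex"

definition minkowski_embed :: "'a::field_char_0 set \<Rightarrow> 'a \<Rightarrow> 'a minkowski" where
  "minkowski_embed K x = (\<lambda>\<sigma>. if \<sigma> \<in> embeddings K then \<sigma> x else 0)"

definition minkowski_inner :: "'a::field_char_0 set \<Rightarrow> 'a minkowski \<Rightarrow> 'a minkowski \<Rightarrow> real" where
  "minkowski_inner K v w = Re (\<Sum>\<sigma>\<in>embeddings K. v \<sigma> * cnj (w \<sigma>))"

definition proj_perp_one :: "'a::field_char_0 set \<Rightarrow> 'a minkowski \<Rightarrow> 'a minkowski" where
  "proj_perp_one K v = (let u = minkowski_embed K 1 in
     (\<lambda>\<sigma>. v \<sigma> - of_real (minkowski_inner K v u / minkowski_inner K u u) * u \<sigma>))"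

definition perp_lattice :: "'a::field_char_0 set \<Rightarrow> 'a minkowski set" where
  "perp_lattice K = (\<lambda>x. proj_perp_one K (minkowski_embed K x)) ` ring_of_integers K"

definition lattice_basis :: "'a minkowski set \<Rightarrow> 'a minkowski \<Rightarrow> 'a minkowski \<Rightarrow> bool" where
  "lattice_basis L v0 v1 \<longleftrightarrow>
     L = {(\<lambda>\<sigma>. of_int m * v0 \<sigma> + of_int n * v1 \<sigma>) | m n :: int. True} \<and>
     (\<forall>s t :: real. (\<forall>\<sigma>. of_real s * v0 \<sigma> + of_real t * v1 \<sigma> = 0) \<longrightarrow> s = 0 \<and> t = 0)"


section \<open>Shapes\<close>

text \<open>Since a matrix of determinant \<open>-1\<close> is a matrix of determinant 1 times the coordinate swap,
  which sends \<open>z\<close> to \<open>1 / cnj z\<close>, it acts by the fractional linear formula applied to \<open>cnj z\<close>.\<close>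

definition gl2z_act :: "int^2^2 \<Rightarrow> complex \<Rightarrow> complex" where
  "gl2z_act A z = (let w = (if det A = 1 then z else cnj z) in
     (of_int (A $ 1 $ 1) * w + of_int (A $ 1 $ 2)) / (of_int (A $ 2 $ 1) * w + of_int (A $ 2 $ 2)))"

definition gl2z_orbit :: "complex \<Rightarrow> complex set" where
  "gl2z_orbit z = {gl2z_act A z | A. invertible A}"

definition basis_point :: "'a::field_char_0 set \<Rightarrow> 'a minkowski \<Rightarrow> 'a minkowski \<Rightarrow> complex" where
  "basis_point K v0 v1 =
     (let B00 = minkowski_inner K v0 v0; B01 = minkowski_inner K v0 v1;
          B11 = minkowski_inner K v1 v1; x = B01 / B00
      in Complex x (sqrt (B11 / B00 - x ^ 2)))"

definition shape :: "'a::field_char_0 set \<Rightarrow> complex set" where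
  "shape K = (THE S. \<exists>v0 v1. lattice_basis (perp_lattice K) v0 v1 \<and>
     S = gl2z_orbit (basis_point K v0 v1))"

definition fund_domain :: "complex set" where
  "fund_domain = {z. Im z > 0 \<and> 0 \<le> Re z \<and> Re z \<le> 1 / 2 \<and> (Re z) ^ 2 + (Im z) ^ 2 \<ge> 1}"

definition rectangular_shape :: "'a::field_char_0 set \<Rightarrow> bool" where
  "rectangular_shape K \<longleftrightarrow>
     (\<exists>v0 v1. lattice_basis (perp_lattice K) v0 v1 \<and> minkowski_inner K v0 v1 = 0)"

definition lattice_symmetry ::
    "'a::field_char_0 set \<Rightarrow> ('a minkowski \<Rightarrow> 'a minkowski) \<Rightarrow> bool" where
  "lattice_symmetry K \<phi> \<longleftrightarrow> bij_betw \<phi> (perp_lattice K) (perp_lattice K) \<and>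
     (\<forall>v\<in>perp_lattice K. \<forall>w\<in>perp_lattice K.
        \<phi> (\<lambda>\<sigma>. v \<sigma> + w \<sigma>) = (\<lambda>\<sigma>. \<phi> v \<sigma> + \<phi> w \<sigma>) \<and>
        minkowski_inner K (\<phi> v) (\<phi> w) = minkowski_inner K v w)"

text \<open>Every lattice has the symmetries \<open>\<plusminus> 1\<close>; a rectangular or rhombic one has
  reflections as well.\<close>

definition no_extra_symmetry :: "'a::field_char_0 set \<Rightarrow> bool" where
  "no_extra_symmetry K \<longleftrightarrow> (\<forall>\<phi>. lattice_symmetry K \<phi> \<longrightarrow>
     (\<forall>v\<in>perp_lattice K. \<phi> v = v) \<or> (\<forall>v\<in>perp_lattice K. \<phi> v = (\<lambda>\<sigma>. - v \<sigma>)))"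

end

theory Submission
  imports Defs "HOL-Number_Theory.Cong"
begin

text \<open>Write \<open>\<alpha> = (ab\<^sup>2)\<^sup>1\<^sup>/\<^sup>3\<close> and \<open>\<beta> = \<alpha>\<^sup>2 / b = (a\<^sup>2b)\<^sup>1\<^sup>/\<^sup>3\<close>. Integrality of trace, second trace and norm
  forces an integer of \<open>K\<close> to have the form \<open>(U + V \<alpha> + W \<beta>) / 3\<close>, and congruences modulo 27 show that
  1, \<open>\<alpha>\<close>, \<open>\<beta>\<close> is an integral basis in Type I, while in Type II, with \<open>a \<equiv> \<epsilon> b\<close> modulo 9, one
  replaces 1 by \<open>(1 + \<epsilon> b \<alpha> + b \<beta>) / 3\<close>. The projection kills 1 and fixes the orthogonal vectors \<open>\<alpha>\<close> and \<open>\<beta>\<close>,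
  whose length ratio is \<open>(a / b)\<^sup>1\<^sup>/\<^sup>3\<close>. Thus the projected lattice has basis \<open>\<alpha>\<close>, \<open>\<beta>\<close> or
  \<open>\<alpha>\<close>, \<open>(\<alpha> + \<epsilon> \<beta>) / 3\<close>.\<close>

section \<open>Pairs of coprime squarefree numbers\<close>

text \<open>The ambient field is only assumed to have characteristic 0, so it need not contain the
  conjugates of \<alpha>, and "real root" has no meaning in it. Norm and second trace are therefore
  polynomials in the coordinates, and their laws are polynomial identities. The norm of an integer
  is a rational all of whose powers have bounded denominator, hence integral; trace and second trace
  come from the norms of \<open>x + 1\<close> and \<open>x - 1\<close>. Lengths are computed only
  after passing to the complex embeddings. The denominator 3 is what the trace form leaves: the
  traces of \<open>x\<close>, \<open>\<alpha> * x\<close> and \<open>\<beta> * x\<close> bound the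
  denominators by 3 and \<open>3 * a * b\<close>, and squarefreeness removes \<open>a * b\<close>.
  The modulus 9 comes from one norm: for \<open>a = \<epsilon> * b + 3 * k\<close> the new basis
  element of Type II has integral norm exactly when 3 divides \<open>k\<close>. Two definite
  descriptions have to be justified. For \<open>shape\<close>, the orbit of one basis point is
  identified with the set of the points of all bases. For \<open>pure_cubic_pair\<close>, all
  elements of \<open>K\<close> whose cube is a natural number are determined.\<close>

lemma squarefree_dvdI:
  fixes a n :: nat
  assumes "squarefree a" "\<And>p. prime p \<Longrightarrow> p dvd a \<Longrightarrow> p dvd n"
  shows "a dvd n"
proof (cases "n = 0")
  case False
  show ?thesis
  proof (rule multiplicity_le_imp_dvd)
    show "a \<noteq> 0" using assms(1) by (metis not_squarefree_0)
    fix p :: nat assume p: "prime p"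
    have "multiplicity p a \<le> 1"
      using assms(1) p squarefree_factorial_semiring'' not_squarefree_0 by metis
    moreover have "multiplicity p n \<ge> 1" if "p dvd a"
      using assms(2)[OF p that] False p
      by (metis One_nat_def Suc_leI not_dvd_imp_multiplicity_0 prime_multiplicity_gt_zero_iff
          prime_imp_prime_elem)
    moreover have "multiplicity p a = 0" if "\<not> p dvd a"
      using that by (rule not_dvd_imp_multiplicity_0)
    ultimately show "multiplicity p a \<le> multiplicity p n"
      by (cases "p dvd a") auto
  qed
qed auto

lemma squarefree_dvd_power:
  fixes a :: nat and n :: int
  assumes "squarefree a" "int a dvd n ^ k"
  shows "int a dvd n"
proof -
  have "int (nat \<bar>n\<bar> ^ k) = \<bar>n ^ k\<bar>" by (simp add: power_abs)
  then have "int a dvd int (nat \<bar>n\<bar> ^ k)" using assms(2) by (simp only: dvd_abs_iff)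
  then have "a dvd nat \<bar>n\<bar> ^ k" by (simp only: of_nat_dvd_iff)
  then have "a dvd nat \<bar>n\<bar>"
    by (intro squarefree_dvdI[OF assms(1)]) (meson dvd_trans prime_dvd_power)
  then show ?thesis by simp
qed

text \<open>A prime divisor of \<open>a * b ^ 2\<close> divides only one of \<open>a\<close> and
  \<open>b\<close>, and only once, so its exponent in the product is 1 or 2.\<close>

lemma cube_dvd_imp_1:
  fixes a b d :: nat
  assumes "squarefree a" "squarefree b" "coprime a b" "d ^ 3 dvd a * b ^ 2"
  shows "d = 1"
proof (rule ccontr)
  assume "d \<noteq> 1"
  then obtain p where p: "prime p" "p dvd d" using prime_factor_nat by blast
  have d: "p ^ 3 dvd a * b ^ 2" using p(2) assms(4) dvd_power_same dvd_trans by blast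
  have sq: "\<not> p ^ 2 dvd a" "\<not> p ^ 2 dvd b"
    using assms(1,2) p(1) squarefreeD not_prime_unit by blast+
  show False
  proof (cases "p dvd b")
    case False
    then have "coprime (p ^ 3) (b ^ 2)" using p(1) by (simp add: prime_imp_coprime)
    then have "p ^ 3 dvd a" using d by (simp add: coprime_dvd_mult_left_iff)
    then show False using sq(1) by (meson dvd_trans le_imp_power_dvd numeral_le_iff semiring_norm)
  next
    case True
    then have "\<not> p dvd a" using assms(3) p(1) by (metis coprime_common_divisor_nat not_prime_1 nat_dvd_1_iff_1)
    then have "coprime (p ^ 3) a" using p(1) by (simp add: prime_imp_coprime)
    then have "p ^ 3 dvd b ^ 2" using d by (simp add: coprime_dvd_mult_right_iff)
    moreover obtain c where c: "b = p * c" using True by blast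
    ultimately have "p ^ 2 * p dvd p ^ 2 * c ^ 2"
      by (simp add: power_mult_distrib power3_eq_cube power2_eq_square)
    then have "p dvd c ^ 2" using p(1) by (subst (asm) dvd_times_left_cancel_iff) auto
    then have "p dvd c" using p(1) prime_dvd_power by blast
    then show False using sq(2) c by (simp add: power2_eq_square)
  qed
qed

text \<open>A prime of \<open>a\<close> has exponent exactly 1 in the common value. If it missed
  \<open>a'\<close>, it would come from \<open>b' ^ 2\<close> and have exponent at least 2.\<close>

lemma squarefree_pair_dvd:
  fixes a b a' b' :: nat
  assumes "squarefree a" "squarefree a'" "coprime a b" "a * b ^ 2 = a' * b' ^ 2"
  shows "a dvd a'"
proof (rule squarefree_dvdI[OF assms(1)])
  fix p assume p: "prime p" "p dvd a"
  show "p dvd a'"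
  proof (rule ccontr)
    assume n: "\<not> p dvd a'"
    have "p dvd a' * b' ^ 2" using p(2) assms(4) by (metis dvd_mult2)
    then have "p dvd b'" using p(1) n by (metis prime_dvd_mult_iff prime_dvd_power)
    then have "p ^ 2 dvd a * b ^ 2" using assms(4) by (simp add: dvd_power_same)
    moreover have "\<not> p dvd b" using assms(3) p by (metis coprime_common_divisor_nat not_prime_1 nat_dvd_1_iff_1)
    then have "coprime (p ^ 2) (b ^ 2)" using p(1) by (simp add: prime_imp_coprime)
    ultimately have "p ^ 2 dvd a" by (simp add: coprime_dvd_mult_left_iff)
    then show False using assms(1) p(1) squarefreeD not_prime_unit by blast
  qed
qed

text \<open>Both products are cube-free, so numerator and denominator of \<open>q\<close> in lowest
  terms must be 1. Taking \<open>(1, 1)\<close> as the second pair also shows that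
  \<open>a * b ^ 2\<close> is not a rational cube.\<close>

lemma squarefree_pair_unique:
  fixes a b a' b' :: nat and q :: rat
  assumes ab: "squarefree a" "squarefree b" "coprime a b"
    and ab': "squarefree a'" "squarefree b'" "coprime a' b'"
    and eq: "of_nat (a * b ^ 2) = q ^ 3 * of_nat (a' * b' ^ 2)"
  shows "a = a' \<and> b = b'"
proof -
  have nz: "a > 0" "b > 0" "a' > 0" "b' > 0" using ab ab' by (auto intro!: Nat.gr0I)
  obtain n d :: int where q: "q = of_int n / of_int d" and d: "d > 0" and cop: "coprime n d"
    by (metis quotient_of_coprime quotient_of_denom_pos quotient_of_div surj_pair)
  have "q ^ 3 > 0"
  proof (rule ccontr)
    assume "\<not> ?thesis"
    then have "q ^ 3 * of_nat (a' * b' ^ 2) \<le> 0"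
      by (metis linorder_not_less mult_nonpos_nonneg of_nat_0_le_iff)
    moreover have "(of_nat (a * b ^ 2) :: rat) > 0" using nz by (simp add: zero_less_mult_iff)
    ultimately show False using eq by simp
  qed
  then have "q > 0" by (simp add: zero_less_power_eq)
  then have n: "n > 0" using q d by (simp add: zero_less_divide_iff)
  define N D where "N = nat n" and "D = nat d"
  have ND: "n = int N" "d = int D" "N > 0" "D > 0" using n d by (auto simp: N_def D_def)
  have copND: "coprime N D" using cop ND by simp
  have "(of_nat (a * b ^ 2 * D ^ 3) :: rat) = of_nat (a' * b' ^ 2 * N ^ 3)"
    using eq ND unfolding q by (simp add: field_simps)
  then have e: "a * b ^ 2 * D ^ 3 = a' * b' ^ 2 * N ^ 3" by (simp only: of_nat_eq_iff)
  have "D ^ 3 dvd a' * b' ^ 2 * N ^ 3" by (metis e dvd_triv_right)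
  then have "D ^ 3 dvd a' * b' ^ 2"
    using copND by (simp add: coprime_dvd_mult_left_iff coprime_commute)
  then have D1: "D = 1" using cube_dvd_imp_1 ab' by blast
  have "N ^ 3 dvd a * b ^ 2 * D ^ 3" by (metis e dvd_triv_right)
  then have "N ^ 3 dvd a * b ^ 2"
    using copND by (simp add: coprime_dvd_mult_left_iff coprime_commute)
  then have N1: "N = 1" using cube_dvd_imp_1 ab by blast
  have e': "a * b ^ 2 = a' * b' ^ 2" using e D1 N1 by simp
  have "a = a'"
    using squarefree_pair_dvd[OF ab(1) ab'(1) ab(3) e'] squarefree_pair_dvd[OF ab'(1) ab(1) ab'(3) e'[symmetric]]
    by (rule dvd_antisym)
  with e' nz show ?thesis by (simp add: power2_eq_iff)
qed

text \<open>Prime cubes are split off by strong induction. For cube-free \<open>m\<close> the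
  decomposition into squarefree part and square already works: a square in \<open>b\<close>, or a
  common prime of \<open>a\<close> and \<open>b\<close>, would put a cube into
  \<open>m\<close>.\<close>

lemma squarefree_pair_exists:
  fixes m :: nat
  assumes "m > 0"
  shows "\<exists>c a b. m = c ^ 3 * (a * b ^ 2) \<and> squarefree a \<and> squarefree b \<and> coprime a b"
  using assms
proof (induction m rule: less_induct)
  case (less m)
  show ?case
  proof (cases "\<exists>p. prime p \<and> p ^ 3 dvd m")
    case True
    then obtain p m' where p: "prime p" and m': "m = p ^ 3 * m'" by blast
    have "m' > 0" using less.prems m' by (auto intro!: Nat.gr0I)
    moreover have "p ^ 3 > 1" using one_less_power[OF prime_gt_1_nat[OF p], of 3] by simp
    ultimately have "m' < m" using m' by simp
    then obtain c a b where "m' = c ^ 3 * (a * b ^ 2)" "squarefree a" "squarefree b" "coprime a b"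
      using less.IH \<open>m' > 0\<close> by blast
    then have "m = (p * c) ^ 3 * (a * b ^ 2) \<and> squarefree a \<and> squarefree b \<and> coprime a b"
      using m' by (simp add: power_mult_distrib mult.assoc)
    then show ?thesis by blast
  next
    case False
    define a b where "a = squarefree_part m" and "b = square_part m"
    have m: "m = a * b ^ 2" unfolding a_def b_def by (rule squarefree_decompose)
    have "squarefree b"
    proof (rule squarefreeI, rule ccontr)
      fix x assume "x ^ 2 dvd b" "\<not> x dvd 1"
      then obtain p where p: "prime p" "p dvd x" using prime_factor_nat by auto
      then have "p ^ 2 dvd b" using \<open>x ^ 2 dvd b\<close> dvd_power_same dvd_trans by blast
      then have "(p ^ 2) ^ 2 dvd m" unfolding m by (intro dvd_mult dvd_power_same)
      then have "p ^ 4 dvd m" by (simp flip: power_mult)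
      then have "p ^ 3 dvd m" by (rule power_le_dvd) simp
      then show False using False p by blast
    qed
    moreover have "coprime a b"
    proof (rule ccontr)
      assume "\<not> coprime a b"
      then obtain p where p: "prime p" "p dvd a" "p dvd b"
        by (metis coprime_iff_gcd_eq_1 dvd_gcdD1 dvd_gcdD2 prime_factor_nat)
      then have "p * p ^ 2 dvd a * b ^ 2" by (intro mult_dvd_mono) (auto simp: dvd_power_same)
      then show False using False p m by (simp add: power3_eq_cube power2_eq_square mult.assoc)
    qed
    moreover have "squarefree a" unfolding a_def by simp
    ultimately have "m = 1 ^ 3 * (a * b ^ 2) \<and> squarefree a \<and> squarefree b \<and> coprime a b"
      using m by simp
    then show ?thesis by blast
  qed
qed

section \<open>Bases and shapes of plane lattices\<close>

no_notation fps_nth (infixl "$" 75)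

definition zcomb :: "int \<Rightarrow> int \<Rightarrow> ('b \<Rightarrow> complex) \<Rightarrow> ('b \<Rightarrow> complex) \<Rightarrow> 'b \<Rightarrow> complex" where
  "zcomb p q v w = (\<lambda>\<sigma>. of_int p * v \<sigma> + of_int q * w \<sigma>)"

lemma zcomb_zcomb:
  "zcomb m n (zcomb p q v w) (zcomb r s v w) = zcomb (m * p + n * r) (m * q + n * s) v w"
  by (simp add: zcomb_def fun_eq_iff algebra_simps)

lemma zcomb_1_0 [simp]: "zcomb 1 0 v w = v" and zcomb_0_1 [simp]: "zcomb 0 1 v w = w"
  by (simp_all add: zcomb_def)

lemma lattice_basis_alt:
  "lattice_basis L v w \<longleftrightarrow> L = {zcomb m n v w | m n. True} \<and>
     (\<forall>s t :: real. (\<forall>\<sigma>. of_real s * v \<sigma> + of_real t * w \<sigma> = 0) \<longrightarrow> s = 0 \<and> t = 0)"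
  by (simp add: lattice_basis_def zcomb_def)

lemma lattice_basis_mem:
  assumes "lattice_basis L v w"
  shows "v \<in> L" "w \<in> L"
proof -
  have "zcomb 1 0 v w \<in> L" "zcomb 0 1 v w \<in> L"
    using assms unfolding lattice_basis_alt by blast+
  then show "v \<in> L" "w \<in> L" by simp_all
qed

lemma lattice_basis_indep:
  assumes "lattice_basis L v w" "\<And>\<sigma>. of_real s * v \<sigma> + of_real t * w \<sigma> = 0"
  shows "s = 0 \<and> t = 0"
  using assms unfolding lattice_basis_def by blast

lemma lattice_basis_zcomb_inj:
  assumes "lattice_basis L v w" "zcomb m n v w = zcomb m' n' v w"
  shows "m = m' \<and> n = n'"
proof -
  have "of_real (of_int (m - m')) * v \<sigma> + of_real (of_int (n - n')) * w \<sigma> = 0" for \<sigma>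
    using fun_cong[OF assms(2), of \<sigma>] by (simp add: zcomb_def algebra_simps)
  from lattice_basis_indep[OF assms(1) this] show ?thesis by simp
qed

lemma lattice_basis_change:
  assumes L: "lattice_basis L v w" and d: "p * s - q * r = 1 \<or> p * s - q * r = (-1 :: int)"
  shows "lattice_basis L (zcomb p q v w) (zcomb r s v w)"
  unfolding lattice_basis_alt
proof (intro conjI allI impI)
  let ?d = "p * s - q * r"
  have dd: "?d * ?d = 1" using d by auto
  have Leq: "L = {zcomb m n v w | m n. True}" using L by (simp add: lattice_basis_alt)
  show "L = {zcomb m n (zcomb p q v w) (zcomb r s v w) | m n. True}"
    unfolding Leq zcomb_zcomb
  proof (intro equalityI subsetI)
    fix x assume "x \<in> {zcomb m n v w | m n. True}"
    then obtain m n where x: "x = zcomb m n v w" by blast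
    \<comment> \<open>The new coordinates come from the inverse matrix, that is, the adjugate
      divided by the determinant, which is its own inverse.\<close>
    define m' n' where "m' = ?d * (m * s - n * r)" and "n' = ?d * (n * p - m * q)"
    have "m' * p + n' * r = (?d * ?d) * m" "m' * q + n' * s = (?d * ?d) * n"
      by (simp_all add: m'_def n'_def algebra_simps)
    then have "x = zcomb (m' * p + n' * r) (m' * q + n' * s) v w" unfolding x dd by simp
    then show "x \<in> {zcomb (m * p + n * r) (m * q + n * s) v w | m n. True}" by blast
  qed blast
  fix S T :: real
  assume "\<forall>\<sigma>. of_real S * zcomb p q v w \<sigma> + of_real T * zcomb r s v w \<sigma> = 0"
  then have "of_real (S * of_int p + T * of_int r) * v \<sigma> + of_real (S * of_int q + T * of_int s) * w \<sigma> = 0" for \<sigma>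
    by (simp add: zcomb_def algebra_simps)
  from lattice_basis_indep[OF L this]
  have e: "S * of_int p + T * of_int r = 0" "S * of_int q + T * of_int s = 0" by auto
  \<comment> \<open>Cramer's rule for the homogeneous system \<open>e\<close>.\<close>
  have "S * of_int ?d = (S * of_int p + T * of_int r) * of_int s - (S * of_int q + T * of_int s) * of_int r"
    "T * of_int ?d = (S * of_int q + T * of_int s) * of_int p - (S * of_int p + T * of_int r) * of_int q"
    by (simp_all add: algebra_simps)
  then have "S * of_int ?d = 0" "T * of_int ?d = 0" by (simp_all only: e mult_zero_left diff_self)
  moreover have "?d \<noteq> 0" using d by linarith
  ultimately show "S = 0" "T = 0" unfolding mult_eq_0_iff of_int_eq_0_iff by blast+
qed

text \<open>Expressing each basis in the other gives two integer matrices with product 1, so their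
  determinants are integers with product 1.\<close>

lemma lattice_basis_unimodular:
  assumes L: "lattice_basis L v w" and L': "lattice_basis L v' w'"
  obtains p q r s where "v' = zcomb p q v w" "w' = zcomb r s v w"
    "p * s - q * r = 1 \<or> p * s - q * r = -1"
proof -
  have ex: "\<exists>m n. x = zcomb m n v' w'" if "lattice_basis L v' w'" "x \<in> L" for v' w' x
    using that unfolding lattice_basis_alt by blast
  obtain p q r s where pq: "v' = zcomb p q v w" "w' = zcomb r s v w"
    using ex[OF L] lattice_basis_mem[OF L'] by metis
  obtain p' q' r' s' where pq': "v = zcomb p' q' v' w'" "w = zcomb r' s' v' w'"
    using ex[OF L'] lattice_basis_mem[OF L] by metis
  have "zcomb 1 0 v w = zcomb (p' * p + q' * r) (p' * q + q' * s) v w"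
    "zcomb 0 1 v w = zcomb (r' * p + s' * r) (r' * q + s' * s) v w"
    unfolding zcomb_zcomb[symmetric] pq[symmetric] pq'[symmetric] by simp_all
  with lattice_basis_zcomb_inj[OF L] have e: "p' * p + q' * r = 1" "p' * q + q' * s = 0"
    "r' * p + s' * r = 0" "r' * q + s' * s = 1" by metis+
  have "(p' * s' - q' * r') * (p * s - q * r)
      = (p' * p + q' * r) * (r' * q + s' * s) - (p' * q + q' * s) * (r' * p + s' * r)"
    by (simp add: algebra_simps)
  also have "\<dots> = 1" by (simp add: e)
  finally have "p * s - q * r = 1 \<or> p * s - q * r = -1"
    unfolding zmult_eq_1_iff by blast
  with pq that show ?thesis by blast
qed

lemma invertible_int_2x2:
  fixes A :: "int^2^2"
  shows "invertible A \<longleftrightarrow> det A = 1 \<or> det A = -1"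
proof
  assume "invertible A"
  then obtain B where "A ** B = mat 1" unfolding invertible_def by blast
  then have "det A * det B = 1" by (metis det_I det_mul)
  then show "det A = 1 \<or> det A = -1" unfolding zmult_eq_1_iff by blast
next
  assume d: "det A = 1 \<or> det A = -1"
  \<comment> \<open>The adjugate of \<open>A\<close>, multiplied instead of divided by the
    determinant \<plusminus>1.\<close>
  define B :: "int^2^2" where
    "B = (\<chi> i j. det A * (if i = j then (if i = 1 then A $ 2 $ 2 else A $ 1 $ 1) else - (A $ i $ j)))"
  have B: "B $ 1 $ 1 = det A * A $ 2 $ 2" "B $ 2 $ 2 = det A * A $ 1 $ 1"
    "B $ 1 $ 2 = - det A * A $ 1 $ 2" "B $ 2 $ 1 = - det A * A $ 2 $ 1"
    by (simp_all add: B_def)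
  have dd: "det A * det A = 1" using d by auto
  have e: "det A * (A $ 1 $ 1 * A $ 2 $ 2) - det A * (A $ 1 $ 2 * A $ 2 $ 1) = 1"
    using dd by (simp add: det_2 algebra_simps)
  have "A ** B = mat 1" "B ** A = mat 1"
    unfolding vec_eq_iff forall_2 matrix_matrix_mult_def mat_def
    using e by (simp_all add: sum_2 B algebra_simps)
  then show "invertible A" unfolding invertible_def by blast
qed

text \<open>Up to scaling, the plane is identified with the complex numbers so that the basis
  becomes 1, \<open>z\<close>. The new basis is then \<open>p + q * z\<close>,
  \<open>r + s * z\<close>, and its point is their quotient. For determinant -1 this quotient lies
  in the lower half-plane, and using \<open>cnj z\<close> moves it to its mirror image. The sums
  \<open>p * q + q * p\<close> are left unsimplified so that the lemma matches instances of
  \<open>minkowski_inner_zcomb\<close>.\<close>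

lemma gram_point_moebius:
  fixes B00 B01 B11 :: real and p q r s :: int
  defines "z \<equiv> Complex (B01 / B00) (sqrt (B11 / B00 - (B01 / B00) ^ 2))"
  defines "C00 \<equiv> of_int p * of_int p * B00 + (of_int p * of_int q + of_int q * of_int p) * B01 + of_int q * of_int q * B11"
    and "C01 \<equiv> of_int p * of_int r * B00 + (of_int p * of_int s + of_int q * of_int r) * B01 + of_int q * of_int s * B11"
    and "C11 \<equiv> of_int r * of_int r * B00 + (of_int r * of_int s + of_int s * of_int r) * B01 + of_int s * of_int s * B11"
  defines "w \<equiv> if p * s - q * r = 1 then z else cnj z"
  assumes pos: "B00 > 0" "B00 * B11 - B01 ^ 2 > 0"
    and d: "p * s - q * r = 1 \<or> p * s - q * r = -1"
  shows "Complex (C01 / C00) (sqrt (C11 / C00 - (C01 / C00) ^ 2))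
    = (of_int s * w + of_int r) / (of_int q * w + of_int p)"
proof -
  define x y where "x = B01 / B00" and "y = sqrt (B11 / B00 - x ^ 2)"
  define P Q R S :: real where "P = of_int p" and "Q = of_int q" and "R = of_int r" and "S = of_int s"
  have "B11 / B00 - x ^ 2 = (B00 * B11 - B01 ^ 2) / B00 ^ 2"
    using pos(1) by (simp add: x_def field_simps power2_eq_square)
  then have gt: "B11 / B00 - x ^ 2 > 0" using pos by simp
  then have y: "y > 0" and y2: "y ^ 2 = B11 / B00 - x ^ 2" by (simp_all add: y_def)
  have B: "B01 = B00 * x" "B11 = B00 * (x ^ 2 + y ^ 2)" using pos(1) y2 by (simp_all add: x_def field_simps)
  have zxy: "z = Complex x y" by (simp add: z_def x_def y_def)
  have "P * S - Q * R = of_int (p * s - q * r)" by (simp add: P_def Q_def R_def S_def)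
  moreover have "real_of_int D = (if D = 1 then 1 else - 1)" if "D = 1 \<or> D = - 1" for D
    using that by auto
  ultimately have PS: "P * S - Q * R = (if p * s - q * r = 1 then 1 else - 1)" using d by metis
  then have D: "(P * S - Q * R) ^ 2 = 1" by (simp only:) simp
  \<comment> \<open>The squared modulus of \<open>q * z + p\<close>, the denominator of the
    fractional linear map.\<close>
  define n where "n = (Q * x + P) ^ 2 + (Q * y) ^ 2"
  have n: "n > 0"
  proof (cases "Q = 0")
    case True
    then have "P \<noteq> 0" using D by auto
    then show ?thesis by (simp add: n_def True)
  next
    case False
    then show ?thesis using y by (simp add: n_def add_nonneg_pos)
  qed
  have C: "C00 = B00 * n" "C01 = B00 * ((Q * x + P) * (S * x + R) + Q * S * y ^ 2)"
    "C11 = B00 * ((S * x + R) ^ 2 + S ^ 2 * y ^ 2)"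
    unfolding C00_def C01_def C11_def B n_def P_def[symmetric] Q_def[symmetric] R_def[symmetric] S_def[symmetric]
    by (simp_all add: power2_eq_square algebra_simps)
  let ?X = "((Q * x + P) * (S * x + R) + Q * S * y ^ 2) / n"
  have X: "C01 / C00 = ?X" using pos(1) by (simp add: C)
  have "C11 / C00 - (C01 / C00) ^ 2
      = (((S * x + R) ^ 2 + S ^ 2 * y ^ 2) * n - ((Q * x + P) * (S * x + R) + Q * S * y ^ 2) ^ 2) / n ^ 2"
    using pos(1) n unfolding X by (simp add: C field_simps power2_eq_square)
  \<comment> \<open>Lagrange's identity: the product of two squared moduli minus the square of the
    inner product is the square of the determinant.\<close>
  also have "((S * x + R) ^ 2 + S ^ 2 * y ^ 2) * n - ((Q * x + P) * (S * x + R) + Q * S * y ^ 2) ^ 2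
      = (P * S - Q * R) ^ 2 * y ^ 2"
    by (simp add: n_def power2_eq_square algebra_simps)
  also have "(P * S - Q * R) ^ 2 * y ^ 2 / n ^ 2 = (y / n) ^ 2" unfolding D by (simp add: power_divide)
  finally have Y: "sqrt (C11 / C00 - (C01 / C00) ^ 2) = y / n" using y n by simp
  \<comment> \<open>The imaginary part of \<open>w\<close>; its sign cancels that of the
    determinant, so both cases share one computation.\<close>
  define y' where "y' = (if p * s - q * r = 1 then y else - y)"
  have w: "w = Complex x y'" by (auto simp: w_def zxy y'_def complex_eq_iff)
  have y'2: "y' ^ 2 = y ^ 2" by (simp add: y'_def)
  have y'D: "(P * S - Q * R) * y' = y" unfolding PS y'_def by simp
  have "(of_int s * w + of_int r) / (of_int q * w + of_int p)
     = Complex (S * x + R) (S * y') / Complex (Q * x + P) (Q * y')"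
  proof -
    have "of_int s * w + of_int r = Complex (S * x + R) (S * y')"
      "of_int q * w + of_int p = Complex (Q * x + P) (Q * y')"
      by (simp_all add: w P_def Q_def R_def S_def complex_eq_iff)
    then show ?thesis by simp
  qed
  also have "\<dots> = Complex ?X (y / n)"
  proof -
    have n': "(Q * x + P) ^ 2 + (Q * y') ^ 2 = n" by (simp add: n_def power_mult_distrib y'2)
    have "(S * x + R) * (Q * x + P) + S * y' * (Q * y') = (Q * x + P) * (S * x + R) + Q * S * y ^ 2"
      unfolding y'2[symmetric] by (simp add: power2_eq_square algebra_simps)
    moreover have "S * y' * (Q * x + P) - (S * x + R) * (Q * y') = y"
      unfolding y'D[symmetric] by (simp add: algebra_simps)
    ultimately show ?thesis
      by (simp add: complex_eq_iff Re_divide Im_divide n')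
  qed
  finally show ?thesis unfolding Y unfolding X by simp
qed

section \<open>Gram matrices of lattice bases and the orbit of their points\<close>

lemma minkowski_inner_commute: "minkowski_inner K v w = minkowski_inner K w v"
  unfolding minkowski_inner_def Re_sum by (intro sum.cong) (simp_all add: mult.commute)

lemma minkowski_inner_lincomb:
  "minkowski_inner K (\<lambda>\<sigma>. of_real s * v \<sigma> + of_real t * w \<sigma>) u
    = s * minkowski_inner K v u + t * minkowski_inner K w u"
  by (simp add: minkowski_inner_def Re_sum sum_distrib_left flip: sum.distrib)
     (simp add: algebra_simps)

lemma minkowski_inner_zcomb:
  "minkowski_inner K (zcomb p q v w) (zcomb r s v w)
    = of_int p * of_int r * minkowski_inner K v v
      + (of_int p * of_int s + of_int q * of_int r) * minkowski_inner K v w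
      + of_int q * of_int s * minkowski_inner K w w"
proof -
  have l: "minkowski_inner K (zcomb p q v w) u = of_int p * minkowski_inner K v u + of_int q * minkowski_inner K w u"
    for p q u
    using minkowski_inner_lincomb[of K "of_int p" v "of_int q" w u] by (simp add: zcomb_def)
  have r: "minkowski_inner K u (zcomb p q v w) = of_int p * minkowski_inner K u v + of_int q * minkowski_inner K u w"
    for p q u
    unfolding minkowski_inner_commute[of K u] by (rule l)
  show ?thesis unfolding l r minkowski_inner_commute[of K w v] by (simp add: algebra_simps)
qed

lemma minkowski_inner_pos:
  assumes "finite (embeddings K)" "\<And>\<sigma>. \<sigma> \<notin> embeddings K \<Longrightarrow> v \<sigma> = 0" "v \<noteq> (\<lambda>_. 0)"
  shows "minkowski_inner K v v > 0"
proof -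
  obtain \<sigma> where s: "v \<sigma> \<noteq> 0" using assms(3) by blast
  have "minkowski_inner K v v = (\<Sum>\<sigma>\<in>embeddings K. (cmod (v \<sigma>)) ^ 2)"
    unfolding minkowski_inner_def Re_sum
    by (intro sum.cong refl) (simp add: complex_mult_cnj cmod_power2)
  also have "\<dots> > 0" using assms(1,2) s by (intro sum_pos2[of _ \<sigma>]) auto
  finally show ?thesis .
qed

text \<open>Both assumptions serve positive definiteness: the inner product sees only values on the
  embeddings, and a sum over an infinite set would be 0 by convention.\<close>

locale minkowski_lattice =
  fixes K :: "'a::field_char_0 set" and L :: "'a minkowski set"
  assumes fin: "finite (embeddings K)"
    and support: "\<And>v \<sigma>. v \<in> L \<Longrightarrow> \<sigma> \<notin> embeddings K \<Longrightarrow> v \<sigma> = 0"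
begin

lemma gram_pos:
  assumes L: "lattice_basis L v w"
  shows "minkowski_inner K v v > 0"
    "minkowski_inner K v v * minkowski_inner K w w - minkowski_inner K v w ^ 2 > 0"
proof -
  have supp: "v \<sigma> = 0" "w \<sigma> = 0" if "\<sigma> \<notin> embeddings K" for \<sigma>
    using support[OF lattice_basis_mem(1)[OF L] that] support[OF lattice_basis_mem(2)[OF L] that] by auto
  have "v \<noteq> (\<lambda>_. 0)"
  proof
    assume "v = (\<lambda>_. 0)"
    then show False using lattice_basis_indep[OF L, of 1 0] by simp
  qed
  then show B00: "minkowski_inner K v v > 0" using supp fin by (intro minkowski_inner_pos)
  let ?B00 = "minkowski_inner K v v" and ?B01 = "minkowski_inner K v w" and ?B11 = "minkowski_inner K w w"
  \<comment> \<open>Gram-Schmidt without division: \<open>u\<close> is \<open>?B00\<close> times the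
    part of \<open>w\<close> orthogonal to \<open>v\<close>, and its squared length is
    \<open>?B00\<close> times the Gram determinant.\<close>
  define u where "u = (\<lambda>\<sigma>. of_real (- ?B01) * v \<sigma> + of_real ?B00 * w \<sigma>)"
  have "u \<noteq> (\<lambda>_. 0)"
  proof
    assume "u = (\<lambda>_. 0)"
    then have "of_real (- ?B01) * v \<sigma> + of_real ?B00 * w \<sigma> = 0" for \<sigma> by (metis u_def)
    then show False using lattice_basis_indep[OF L, of "- ?B01" ?B00] B00 by simp
  qed
  then have "minkowski_inner K u u > 0" using fin supp by (intro minkowski_inner_pos) (auto simp: u_def)
  also have uu: "minkowski_inner K u x = - ?B01 * minkowski_inner K v x + ?B00 * minkowski_inner K w x" for x
    unfolding u_def by (rule minkowski_inner_lincomb)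
  have "minkowski_inner K u u = ?B00 * (?B00 * ?B11 - ?B01 ^ 2)"
  proof -
    have vu: "minkowski_inner K v u = - ?B01 * ?B00 + ?B00 * ?B01"
      unfolding minkowski_inner_commute[of K v u] uu[of v] minkowski_inner_commute[of K w v] by simp
    have wu: "minkowski_inner K w u = - ?B01 * ?B01 + ?B00 * ?B11"
      unfolding minkowski_inner_commute[of K w u] uu[of w] by simp
    show ?thesis unfolding uu[of u] vu wu by (simp add: power2_eq_square algebra_simps)
  qed
  finally show "?B00 * ?B11 - ?B01 ^ 2 > 0" using B00 by (simp add: zero_less_mult_iff)
qed

lemma basis_point_change:
  assumes L: "lattice_basis L v w"
    and d: "p * s - q * r = 1 \<or> p * s - q * r = -1"
  defines "z \<equiv> basis_point K v w"
  shows "basis_point K (zcomb p q v w) (zcomb r s v w)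
    = (let y = (if p * s - q * r = 1 then z else cnj z) in
        (of_int s * y + of_int r) / (of_int q * y + of_int p))"
  unfolding z_def basis_point_def Let_def minkowski_inner_zcomb
  by (rule gram_point_moebius[OF gram_pos[OF L] d])

text \<open>The right-hand side does not mention the chosen basis, so the orbit is the same for all
  bases; this is what makes the definite description in \<open>shape\<close> meaningful.\<close>

lemma gl2z_orbit_basis_point:
  assumes L: "lattice_basis L v w"
  shows "gl2z_orbit (basis_point K v w) = {basis_point K v' w' | v' w'. lattice_basis L v' w'}"
proof (intro equalityI subsetI)
  fix y assume "y \<in> gl2z_orbit (basis_point K v w)"
  then obtain A where A: "invertible A" "y = gl2z_act A (basis_point K v w)"
    unfolding gl2z_orbit_def by blast
  have det: "det A = A $ 2 $ 2 * A $ 1 $ 1 - A $ 2 $ 1 * A $ 1 $ 2" by (simp add: det_2 mult.commute)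
  have d: "A $ 2 $ 2 * A $ 1 $ 1 - A $ 2 $ 1 * A $ 1 $ 2 = 1 \<or> A $ 2 $ 2 * A $ 1 $ 1 - A $ 2 $ 1 * A $ 1 $ 2 = -1"
    using A(1) unfolding invertible_int_2x2 det .
  have "y = basis_point K (zcomb (A $ 2 $ 2) (A $ 2 $ 1) v w) (zcomb (A $ 1 $ 2) (A $ 1 $ 1) v w)"
    unfolding A(2) gl2z_act_def det basis_point_change[OF L d] by (rule refl)
  with lattice_basis_change[OF L d] show "y \<in> {basis_point K v' w' | v' w'. lattice_basis L v' w'}"
    by (intro CollectI exI conjI)
next
  fix y assume "y \<in> {basis_point K v' w' | v' w'. lattice_basis L v' w'}"
  then obtain v' w' where y: "y = basis_point K v' w'" and L': "lattice_basis L v' w'" by blast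
  obtain p q r s where vw: "v' = zcomb p q v w" "w' = zcomb r s v w" and d: "p * s - q * r = 1 \<or> p * s - q * r = -1"
    using lattice_basis_unimodular[OF L L'] .
  \<comment> \<open>Rows and columns are reversed because the point is the quotient of the second
    basis vector by the first.\<close>
  define A :: "int^2^2" where "A = vector [vector [s, r], vector [q, p]]"
  have A: "A $ 1 $ 1 = s" "A $ 1 $ 2 = r" "A $ 2 $ 1 = q" "A $ 2 $ 2 = p" by (simp_all add: A_def)
  have det: "det A = p * s - q * r" by (simp add: det_2 A mult.commute)
  have "y = gl2z_act A (basis_point K v w)"
    unfolding gl2z_act_def det A y vw basis_point_change[OF L d] by (rule refl)
  moreover have "invertible A" using d unfolding invertible_int_2x2 det .
  ultimately show "y \<in> gl2z_orbit (basis_point K v w)" unfolding gl2z_orbit_def by blast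
qed

end

lemma basis_point_in_shape:
  assumes "minkowski_lattice K (perp_lattice K)" "lattice_basis (perp_lattice K) v w"
  shows "basis_point K v w \<in> shape K"
proof -
  interpret minkowski_lattice K "perp_lattice K" by fact
  have "shape K = {basis_point K v' w' | v' w'. lattice_basis (perp_lattice K) v' w'}"
    unfolding shape_def
  proof (rule the_equality)
    show "\<exists>v0 v1. lattice_basis (perp_lattice K) v0 v1 \<and>
        {basis_point K v' w' | v' w'. lattice_basis (perp_lattice K) v' w'} = gl2z_orbit (basis_point K v0 v1)"
      using assms(2) gl2z_orbit_basis_point[OF assms(2)] by metis
  next
    fix S assume "\<exists>v0 v1. lattice_basis (perp_lattice K) v0 v1 \<and> S = gl2z_orbit (basis_point K v0 v1)"
    then obtain v0 v1 where "lattice_basis (perp_lattice K) v0 v1" "S = gl2z_orbit (basis_point K v0 v1)"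
      by blast
    then show "S = {basis_point K v' w' | v' w'. lattice_basis (perp_lattice K) v' w'}"
      by (simp only: gl2z_orbit_basis_point)
  qed
  then show ?thesis using assms(2) by blast
qed

section \<open>Coordinates in a pure cubic field\<close>

text \<open>If \<open>d\<close> is the denominator of \<open>q\<close>, then every power
  \<open>d ^ k\<close> divides \<open>M\<close>; for \<open>d\<close> at least 2 the exponent
  \<bar>M\<bar> is already too large.\<close>

lemma rat_power_bounded_denom_imp_int:
  fixes q :: rat and M :: int
  assumes "M \<noteq> 0" "\<And>k. of_int M * q ^ k \<in> \<int>"
  shows "q \<in> \<int>"
proof -
  obtain n d :: int where q: "q = of_int n / of_int d" and d: "d > 0" and cop: "coprime n d"
    by (metis quotient_of_coprime quotient_of_denom_pos quotient_of_div surj_pair)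
  have dvd: "d ^ k dvd M" for k
  proof -
    obtain j where j: "of_int M * q ^ k = (of_int j :: rat)" using assms(2)[of k] by (elim Ints_cases)
    then have "(of_int (M * n ^ k) :: rat) = of_int (j * d ^ k)"
      using d unfolding q by (simp add: field_simps)
    then have "M * n ^ k = j * d ^ k" by (simp only: of_int_eq_iff)
    then have "d ^ k dvd M * n ^ k" by simp
    then show ?thesis using cop by (simp add: coprime_dvd_mult_left_iff coprime_commute)
  qed
  have "d = 1"
  proof (rule ccontr)
    assume "d \<noteq> 1"
    then have "d \<ge> 2" using d by simp
    define k where "k = nat \<bar>M\<bar>"
    have "int k < 2 ^ k" by (metis of_nat_less_two_power)
    also have "(2::int) ^ k \<le> d ^ k" using \<open>d \<ge> 2\<close> by (intro power_mono) auto
    also have "d ^ k \<le> \<bar>M\<bar>" using dvd_imp_le_int[OF assms(1) dvd[of k]] d by simp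
    finally show False by (simp add: k_def)
  qed
  then show ?thesis using q by simp
qed

lemma is_subfield_hull: "is_subfield (is_subfield hull S)"
  by (rule hull_in) (auto simp: is_subfield_def)

lemma subfield_add: "is_subfield F \<Longrightarrow> x \<in> F \<Longrightarrow> y \<in> F \<Longrightarrow> x + y \<in> F"
  and subfield_diff: "is_subfield F \<Longrightarrow> x \<in> F \<Longrightarrow> y \<in> F \<Longrightarrow> x - y \<in> F"
  and subfield_mult: "is_subfield F \<Longrightarrow> x \<in> F \<Longrightarrow> y \<in> F \<Longrightarrow> x * y \<in> F"
  and subfield_inverse: "is_subfield F \<Longrightarrow> x \<in> F \<Longrightarrow> inverse x \<in> F"
  and subfield_0: "is_subfield F \<Longrightarrow> 0 \<in> F"
  and subfield_1: "is_subfield F \<Longrightarrow> 1 \<in> F"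
  unfolding is_subfield_def by blast+

lemma is_subfield_of_rat:
  fixes F :: "'a::field_char_0 set"
  assumes "is_subfield F"
  shows "of_rat q \<in> F"
proof -
  have n: "of_nat n \<in> F" for n
    using assms by (induction n) (simp_all add: subfield_0 subfield_1 subfield_add)
  have i: "of_int z \<in> F" for z
  proof (cases z)
    case (nonneg n)
    then show ?thesis using n by simp
  next
    case (neg n)
    then have "of_int z = 0 - (of_nat (Suc n) :: 'a)" by simp
    also have "\<dots> \<in> F" by (intro subfield_diff subfield_0 assms n)
    finally show ?thesis .
  qed
  obtain c d where q: "q = of_int c / of_int d"
    by (metis quotient_of_div surj_pair)
  have "of_rat q = of_int c * inverse (of_int d :: 'a)"
    by (simp add: q divide_inverse of_rat_mult of_rat_inverse)
  also have "\<dots> \<in> F" by (intro subfield_mult subfield_inverse i assms)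
  finally show ?thesis .
qed

text \<open>Stated for abstract \<open>x\<close> and \<open>y\<close> because it is applied twice:
  to \<alpha> and \<beta> in the ambient field, and to their images in the complex numbers.\<close>

lemma cubic_basis_mult:
  fixes x y :: "'b::field_char_0" and a b :: nat
  assumes "x ^ 2 = of_nat b * y" "y ^ 2 = of_nat a * x" "x * y = of_nat (a * b)"
  shows "(of_rat u + of_rat v * x + of_rat w * y) * (of_rat u' + of_rat v' * x + of_rat w' * y)
    = of_rat (u * u' + of_nat (a * b) * (v * w' + w * v'))
      + of_rat (u * v' + v * u' + of_nat a * w * w') * x
      + of_rat (u * w' + w * u' + of_nat b * v * v') * y"
proof -
  have "(of_rat u + of_rat v * x + of_rat w * y) * (of_rat u' + of_rat v' * x + of_rat w' * y)
     = of_rat u * of_rat u' + of_rat (v * w' + w * v') * (x * y)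
     + of_rat (u * v' + v * u') * x + of_rat (w * w') * y ^ 2
     + of_rat (u * w' + w * u') * y + of_rat (v * v') * x ^ 2"
    by (simp add: of_rat_add of_rat_mult algebra_simps power2_eq_square)
  then show ?thesis unfolding assms
    by (simp add: of_rat_add of_rat_mult algebra_simps)
qed

locale pure_cubic =
  fixes K :: "'a::field_char_0 set" and a b :: nat and \<alpha> :: 'a
  assumes sqf_a: "squarefree a" and sqf_b: "squarefree b" and cop: "coprime a b"
    and b_less_a: "b < a"
    and alpha_cube: "\<alpha> ^ 3 = of_nat (a * b ^ 2)"
    and K_hull: "K = is_subfield hull {\<alpha>}"
begin

definition \<beta> :: 'a where "\<beta> = \<alpha> ^ 2 / of_nat b"

definition el :: "rat \<Rightarrow> rat \<Rightarrow> rat \<Rightarrow> 'a" where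
  "el u v w = of_rat u + of_rat v * \<alpha> + of_rat w * \<beta>"

text \<open>The norm form: with \<open>x = u\<close>, \<open>y = v * \<alpha>\<close>,
  \<open>z = w * \<beta>\<close> it is \<open>x ^ 3 + y ^ 3 + z ^ 3 - 3 * x * y * z\<close>, the
  product of the three conjugates.\<close>

definition nm :: "rat \<Rightarrow> rat \<Rightarrow> rat \<Rightarrow> rat" where
  "nm u v w = u ^ 3 + of_nat (a * b ^ 2) * v ^ 3 + of_nat (a ^ 2 * b) * w ^ 3
     - 3 * of_nat (a * b) * u * v * w"

lemma a_pos: "a > 0" and b_pos: "b > 0"
  using sqf_a sqf_b by (metis not_squarefree_0 gr0I)+

lemma alpha2: "\<alpha> ^ 2 = of_nat b * \<beta>"
  using b_pos by (simp add: \<beta>_def)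

lemma alpha_beta: "\<alpha> * \<beta> = of_nat (a * b)"
proof -
  have "\<alpha> * \<beta> = \<alpha> ^ 3 / of_nat b" by (simp add: \<beta>_def power3_eq_cube power2_eq_square)
  then show ?thesis using b_pos by (simp add: alpha_cube power2_eq_square)
qed

lemma beta2: "\<beta> ^ 2 = of_nat a * \<alpha>"
proof -
  have "of_nat b * \<beta> ^ 2 = \<alpha> * (\<alpha> * \<beta>)"
    by (metis alpha2 mult.assoc power2_eq_square)
  also have "\<dots> = of_nat b * (of_nat a * \<alpha>)" unfolding alpha_beta by simp
  finally show ?thesis using b_pos by simp
qed

lemma el_mult:
  "el u v w * el u' v' w' = el (u * u' + of_nat (a * b) * (v * w' + w * v'))
     (u * v' + v * u' + of_nat a * w * w') (u * w' + w * u' + of_nat b * v * v')"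
  unfolding el_def by (rule cubic_basis_mult[OF alpha2 beta2 alpha_beta])

lemma el_add: "el u v w + el u' v' w' = el (u + u') (v + v') (w + w')"
  by (simp add: el_def of_rat_add algebra_simps)

lemma el_diff: "el u v w - el u' v' w' = el (u - u') (v - v') (w - w')"
  by (simp add: el_def of_rat_diff algebra_simps)

lemma el_rat: "of_rat u = el u 0 0"
  by (simp add: el_def)

lemma el_int: "of_int n = el (of_int n) 0 0"
  by (simp add: el_def)

lemma el_0: "0 = el 0 0 0"
  by (simp add: el_def)

lemma el_1: "1 = el 1 0 0"
  by (simp add: el_def)

lemma el_scale: "of_rat q * el u v w = el (q * u) (q * v) (q * w)"
  by (simp add: el_def of_rat_mult algebra_simps)

lemma el_scale_int: "of_int q * el u v w = el (of_int q * u) (of_int q * v) (of_int q * w)"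
  by (simp add: el_def of_rat_mult algebra_simps)

lemma not_cube: "of_nat (a * b ^ 2) \<noteq> (q :: rat) ^ 3"
proof
  assume "of_nat (a * b ^ 2) = q ^ 3"
  then have "of_nat (a * b ^ 2) = q ^ 3 * of_nat (1 * 1 ^ 2)" by simp
  from squarefree_pair_unique[OF sqf_a sqf_b cop _ _ _ this] show False using b_less_a by simp
qed

lemma ratio_not_cube:
  assumes "of_nat a * z ^ 3 = of_nat b * (y :: rat) ^ 3"
  shows "y = 0 \<and> z = 0"
proof (cases "z = 0")
  case True
  then show ?thesis using assms b_pos by simp
next
  case False
  then have "of_nat (a * b ^ 2) = (of_nat b * y / z) ^ 3"
    using assms by (simp add: field_simps power2_eq_square power3_eq_cube)
  then show ?thesis using not_cube by blast
qed

lemma lin_indep_alpha: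
  assumes "of_rat p + of_rat q * \<alpha> = 0"
  shows "p = 0 \<and> q = 0"
proof (cases "q = 0")
  case True
  then show ?thesis using assms by simp
next
  case False
  then have "\<alpha> = of_rat (- p / q)"
    using assms by (simp add: of_rat_divide of_rat_minus field_simps add_eq_0_iff)
  then have "of_rat ((- p / q) ^ 3) = \<alpha> ^ 3" by (simp only: of_rat_power)
  also have "\<dots> = of_rat (of_nat (a * b ^ 2))" by (simp only: alpha_cube of_rat_of_nat_eq)
  finally have "(- p / q) ^ 3 = of_nat (a * b ^ 2)" by (simp only: of_rat_eq_iff)
  then show ?thesis using not_cube by metis
qed

text \<open>The two equations combine to \<open>a * w ^ 3 = b * v ^ 3\<close>. They arise both as
  the obstruction to linear independence and as the vanishing of the cofactor of the norm.\<close>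

lemma common_zero:
  fixes u v w :: rat
  assumes "u * w = of_nat b * v ^ 2" "of_nat a * w ^ 2 = u * v"
  shows "v = 0 \<and> w = 0"
proof (rule ratio_not_cube)
  have "of_nat a * w ^ 3 = (of_nat a * w ^ 2) * w" by (simp add: power3_eq_cube power2_eq_square)
  also have "\<dots> = (u * w) * v" unfolding assms(2) by simp
  also have "\<dots> = of_nat b * v ^ 3" unfolding assms(1) by (simp add: power3_eq_cube power2_eq_square)
  finally show "of_nat a * w ^ 3 = of_nat b * v ^ 3" .
qed

lemma el_eq_0:
  assumes "el u v w = 0"
  shows "u = 0 \<and> v = 0 \<and> w = 0"
proof -
  \<comment> \<open>The multiplier \<open>w * \<alpha> - b * v\<close> is chosen to cancel the
    coefficient of \<beta>, which leaves a linear relation for \<alpha>.\<close>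
  have "el (of_nat (a * b) * w ^ 2 - of_nat b * (u * v)) (u * w - of_nat b * v ^ 2) 0
      = el u v w * el (- (of_nat b * v)) w 0"
    unfolding el_mult by (simp add: power2_eq_square algebra_simps)
  then have "el (of_nat (a * b) * w ^ 2 - of_nat b * (u * v)) (u * w - of_nat b * v ^ 2) 0 = 0"
    using assms by simp
  then have "of_nat (a * b) * w ^ 2 - of_nat b * (u * v) = 0 \<and> u * w - of_nat b * v ^ 2 = 0"
    by (intro lin_indep_alpha) (simp add: el_def)
  then have vw: "v = 0 \<and> w = 0" using b_pos by (intro common_zero[of u]) auto
  then show ?thesis using assms by (simp add: el_def)
qed

lemma el_eq_iff: "el u v w = el u' v' w' \<longleftrightarrow> u = u' \<and> v = v' \<and> w = w'"
  using el_eq_0[of "u - u'" "v - v'" "w - w'"] el_diff[of u v w u' v' w'] by auto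

lemma nm_mult:
  "nm (u * u' + of_nat (a * b) * (v * w' + w * v')) (u * v' + v * u' + of_nat a * w * w')
     (u * w' + w * u' + of_nat b * v * v') = nm u v w * nm u' v' w'"
  by (simp add: nm_def power2_eq_square power3_eq_cube algebra_simps)

text \<open>The second factor is the product of the other two conjugates, from the factorisation of
  \<open>x ^ 3 + y ^ 3 + z ^ 3 - 3 * x * y * z\<close> with linear factor \<open>x + y + z\<close>.
  Divided by the norm, it gives inverses.\<close>

lemma el_cofactor:
  "el u v w * el (u ^ 2 - of_nat (a * b) * v * w) (of_nat a * w ^ 2 - u * v)
     (of_nat b * v ^ 2 - u * w) = of_rat (nm u v w)"
  unfolding el_mult el_rat el_eq_iff nm_def
  by (simp add: power2_eq_square power3_eq_cube algebra_simps)

lemma nm_eq_0: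
  assumes "nm u v w = 0"
  shows "u = 0 \<and> v = 0 \<and> w = 0"
proof -
  have "el u v w * el (u ^ 2 - of_nat (a * b) * v * w) (of_nat a * w ^ 2 - u * v)
     (of_nat b * v ^ 2 - u * w) = 0" using el_cofactor assms by simp
  then consider "el u v w = 0" | "el (u ^ 2 - of_nat (a * b) * v * w) (of_nat a * w ^ 2 - u * v)
     (of_nat b * v ^ 2 - u * w) = 0" unfolding mult_eq_0_iff by blast
  then show ?thesis
  proof cases
    case 1
    then show ?thesis by (rule el_eq_0)
  next
    case 2
    from el_eq_0[OF this] have e: "u ^ 2 = of_nat (a * b) * v * w" "of_nat a * w ^ 2 = u * v"
      "u * w = of_nat b * v ^ 2" by (simp_all only: right_minus_eq)
    then have "v = 0 \<and> w = 0" by (intro common_zero)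
    then show ?thesis using e(1) by simp
  qed
qed

lemma is_subfield_el: "is_subfield {el u v w | u v w. True}"
  unfolding is_subfield_def
proof (intro conjI ballI)
  show "0 \<in> {el u v w | u v w. True}" using el_0 by auto
  show "1 \<in> {el u v w | u v w. True}" using el_1 by blast
next
  fix x y assume "x \<in> {el u v w | u v w. True}" "y \<in> {el u v w | u v w. True}"
  then obtain u v w u' v' w' where xy: "x = el u v w" "y = el u' v' w'" by auto
  show "x + y \<in> {el u v w | u v w. True}" unfolding xy el_add by auto
  show "x - y \<in> {el u v w | u v w. True}" unfolding xy el_diff by auto
  show "x * y \<in> {el u v w | u v w. True}" unfolding xy el_mult by auto
next
  fix x assume "x \<in> {el u v w | u v w. True}"
  then obtain u v w where x: "x = el u v w" by blast
  show "inverse x \<in> {el u v w | u v w. True}"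
  proof (cases "nm u v w = 0")
    case True
    then have "u = 0 \<and> v = 0 \<and> w = 0" by (rule nm_eq_0)
    then have "x = 0" using x by (simp add: el_def)
    then show ?thesis using el_0 by auto
  next
    case False
    define y where "y = el (u ^ 2 - of_nat (a * b) * v * w) (of_nat a * w ^ 2 - u * v)
     (of_nat b * v ^ 2 - u * w)"
    have "x * (of_rat (inverse (nm u v w)) * y) = of_rat (inverse (nm u v w)) * of_rat (nm u v w)"
      using el_cofactor[of u v w] by (simp add: x y_def mult.left_commute)
    also have "\<dots> = 1" using False by (simp flip: of_rat_mult)
    finally have "inverse x = of_rat (inverse (nm u v w)) * y" by (rule inverse_unique)
    then show ?thesis unfolding y_def el_scale by blast
  qed
qed

lemma K_subfield: "is_subfield K"
  unfolding K_hull by (rule is_subfield_hull)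

lemma alpha_in_K: "\<alpha> \<in> K"
  unfolding K_hull by (simp add: hull_inc)

lemma beta_in_K: "\<beta> \<in> K"
proof -
  have "\<beta> = \<alpha> * \<alpha> * inverse (of_rat (of_nat b))"
    by (simp add: \<beta>_def divide_inverse power2_eq_square)
  also have "\<dots> \<in> K"
    by (intro subfield_mult subfield_inverse K_subfield alpha_in_K is_subfield_of_rat)
  finally show ?thesis .
qed

lemma K_eq: "K = {el u v w | u v w. True}"
proof (rule antisym)
  have "\<alpha> = el 0 1 0" by (simp add: el_def)
  then have "{\<alpha>} \<subseteq> {el u v w | u v w. True}" by blast
  then show "K \<subseteq> {el u v w | u v w. True}"
    unfolding K_hull using is_subfield_el by (rule hull_minimal)
  have "el u v w \<in> K" for u v w
    unfolding el_def
    by (intro subfield_add subfield_mult K_subfield alpha_in_K beta_in_K is_subfield_of_rat)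
  then show "{el u v w | u v w. True} \<subseteq> K" by blast
qed

end

section \<open>Integral elements\<close>

context pure_cubic
begin

text \<open>The order spanned by 1, \<alpha> and \<beta>; it is closed under products since the
  structure constants \<open>a\<close>, \<open>b\<close> and \<open>a * b\<close> are
  integers.\<close>

definition R :: "'a set" where
  "R = {el (of_int p) (of_int q) (of_int r) | p q r. True}"

text \<open>For an element of \<open>K\<close> this is equivalent to integrality, but closure under sums
  and products is immediate.\<close>

definition almost_integral :: "'a \<Rightarrow> bool" where
  "almost_integral x \<longleftrightarrow> (\<exists>N::int. N \<noteq> 0 \<and> (\<forall>k. of_int N * x ^ k \<in> R))"

lemma el_in_R: "el (of_int p) (of_int q) (of_int r) \<in> R"
  unfolding R_def by blast

lemma R_cases:
  assumes "x \<in> R"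
  obtains p q r where "x = el (of_int p) (of_int q) (of_int r)"
  using assms unfolding R_def by blast

lemma el_in_R_iff: "el u v w \<in> R \<longleftrightarrow> u \<in> \<int> \<and> v \<in> \<int> \<and> w \<in> \<int>"
  by (auto simp: R_def el_eq_iff elim!: Ints_cases)

lemma R_add: "x \<in> R \<Longrightarrow> y \<in> R \<Longrightarrow> x + y \<in> R"
  by (elim R_cases) (simp add: el_add el_in_R_iff)

lemma R_mult: "x \<in> R \<Longrightarrow> y \<in> R \<Longrightarrow> x * y \<in> R"
  by (elim R_cases) (simp add: el_mult el_in_R_iff)

lemma R_int: "of_int n \<in> R"
  by (simp add: el_int el_in_R_iff)

lemma R_power: "x \<in> R \<Longrightarrow> x ^ k \<in> R"
  using R_int[of 1] by (induction k) (auto intro: R_mult)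

lemma R_sum: "(\<And>i. i \<in> A \<Longrightarrow> f i \<in> R) \<Longrightarrow> sum f A \<in> R"
  using R_int[of 0] by (induction A rule: infinite_finite_induct) (auto intro: R_add)

lemma almost_integral_R: "x \<in> R \<Longrightarrow> almost_integral x"
  unfolding almost_integral_def by (rule exI[of _ 1]) (simp add: R_power)

lemma almost_integral_add:
  assumes "almost_integral x" "almost_integral y"
  shows "almost_integral (x + y)"
proof -
  obtain N M :: int where N: "N \<noteq> 0" "\<And>k. of_int N * x ^ k \<in> R" and M: "M \<noteq> 0" "\<And>k. of_int M * y ^ k \<in> R"
    using assms unfolding almost_integral_def by blast
  have "of_int (N * M) * (x + y) ^ k \<in> R" for k
  proof -
    have "of_int (N * M) * (x + y) ^ k
        = (\<Sum>i\<le>k. of_int (int (k choose i)) * ((of_int N * x ^ i) * (of_int M * y ^ (k - i))))"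
      unfolding binomial_ring sum_distrib_left by (intro sum.cong refl) simp
    also have "\<dots> \<in> R" by (intro R_sum R_mult R_int N(2) M(2))
    finally show ?thesis .
  qed
  moreover have "N * M \<noteq> 0" using N(1) M(1) by simp
  ultimately show ?thesis unfolding almost_integral_def by blast
qed

lemma almost_integral_mult:
  assumes "almost_integral x" "almost_integral y"
  shows "almost_integral (x * y)"
proof -
  obtain N M :: int where N: "N \<noteq> 0" "\<And>k. of_int N * x ^ k \<in> R" and M: "M \<noteq> 0" "\<And>k. of_int M * y ^ k \<in> R"
    using assms unfolding almost_integral_def by blast
  have "of_int (N * M) * (x * y) ^ k \<in> R" for k
  proof -
    have "of_int (N * M) * (x * y) ^ k = (of_int N * x ^ k) * (of_int M * y ^ k)"
      by (simp add: power_mult_distrib)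
    also have "\<dots> \<in> R" by (intro R_mult N(2) M(2))
    finally show ?thesis .
  qed
  moreover have "N * M \<noteq> 0" using N(1) M(1) by simp
  ultimately show ?thesis unfolding almost_integral_def by blast
qed

lemma common_denom:
  assumes "x \<in> K"
  obtains N :: int where "N \<noteq> 0" "of_int N * x \<in> R"
proof -
  obtain u v w where x: "x = el u v w" using assms K_eq by blast
  have "\<exists>d :: int. d \<noteq> 0 \<and> of_int d * q \<in> \<int>" for q :: rat
  proof -
    obtain n d :: int where q: "q = of_int n / of_int d" and d: "d > 0"
      by (metis quotient_of_denom_pos quotient_of_div surj_pair)
    then show ?thesis by (intro exI[of _ d]) simp
  qed
  then obtain d1 d2 d3 :: int where d: "d1 \<noteq> 0" "of_int d1 * u \<in> \<int>" "d2 \<noteq> 0" "of_int d2 * v \<in> \<int>"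
     "d3 \<noteq> 0" "of_int d3 * w \<in> \<int>" by meson
  have "of_int (d2 * d3) * (of_int d1 * u) \<in> \<int>" "of_int (d1 * d3) * (of_int d2 * v) \<in> \<int>"
    "of_int (d1 * d2) * (of_int d3 * w) \<in> \<int>" by (intro Ints_mult Ints_of_int d)+
  then have "of_int (d1 * d2 * d3) * x \<in> R"
    unfolding x el_scale_int el_in_R_iff by (simp add: ac_simps)
  moreover have "d1 * d2 * d3 \<noteq> 0" using d by simp
  ultimately show ?thesis by (intro that)
qed

text \<open>If \<open>N\<close> clears the denominators of \<open>x\<close>, then
  \<open>N ^ d\<close> clears those of all powers below the degree \<open>d\<close>, and the monic
  equation reduces every higher power to smaller ones with integer coefficients.\<close>

lemma algebraic_int_imp_almost_integral:
  assumes "x \<in> K" "algebraic_int x"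
  shows "almost_integral x"
proof -
  obtain p :: "'a poly" where p: "lead_coeff p = 1" "\<And>i. coeff p i \<in> \<int>" "poly p x = 0"
    using assms(2) by (auto elim: algebraic_int.cases)
  define d where "d = degree p"
  obtain N :: int where N: "N \<noteq> 0" "of_int N * x \<in> R" using common_denom[OF assms(1)] .
  have xd: "x ^ d = - (\<Sum>i<d. coeff p i * x ^ i)"
  proof -
    have "0 = (\<Sum>i\<le>d. coeff p i * x ^ i)" using p(3) by (simp add: poly_altdef d_def)
    also have "{..d} = insert d {..<d}" by auto
    also have "(\<Sum>i\<in>insert d {..<d}. coeff p i * x ^ i) = x ^ d + (\<Sum>i<d. coeff p i * x ^ i)"
      using p(1) by (simp add: d_def)
    finally show ?thesis by (simp add: eq_neg_iff_add_eq_0)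
  qed
  have "of_int (N ^ d) * x ^ k \<in> R" for k
  proof (induction k rule: less_induct)
    case (less k)
    show ?case
    proof (cases "k < d")
      case True
      have "N ^ d = N ^ (d - k) * N ^ k" using True by (simp flip: power_add)
      then have "of_int (N ^ d) * x ^ k = of_int (N ^ (d - k)) * (of_int N * x) ^ k"
        by (simp add: power_mult_distrib)
      then show ?thesis using N(2) by (simp only: R_mult R_int R_power)
    next
      case False
      then have "x ^ k = x ^ d * x ^ (k - d)" by (simp flip: power_add)
      then have "of_int (N ^ d) * x ^ k = (\<Sum>i<d. - coeff p i * (of_int (N ^ d) * x ^ (i + (k - d))))"
        unfolding xd by (simp add: sum_distrib_left sum_distrib_right sum_negf power_add ac_simps)
      also have "\<dots> \<in> R"
      proof (rule R_sum, rule R_mult)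
        fix i assume "i \<in> {..<d}"
        then show "of_int (N ^ d) * x ^ (i + (k - d)) \<in> R" using False by (intro less.IH) auto
        obtain z where "coeff p i = of_int z" using p(2)[of i] by (elim Ints_cases)
        then show "- coeff p i \<in> R" using R_int[of "- z"] by simp
      qed
      finally show ?thesis .
    qed
  qed
  moreover have "N ^ d \<noteq> 0" using N(1) by simp
  ultimately show ?thesis unfolding almost_integral_def by blast
qed

section \<open>Integrality of norm, second trace and trace\<close>

lemma el_power:
  "\<exists>u' v' w'. el u v w ^ k = el u' v' w' \<and> nm u v w ^ k = nm u' v' w'"
proof (induction k)
  case 0
  have "el u v w ^ 0 = el 1 0 0 \<and> nm u v w ^ 0 = nm 1 0 0" by (simp add: nm_def flip: el_1)
  then show ?case by blast
next
  case (Suc k)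
  then obtain u' v' w' where "el u v w ^ k = el u' v' w'" "nm u v w ^ k = nm u' v' w'" by blast
  then have "el u v w ^ Suc k = el u v w * el u' v' w'" "nm u v w ^ Suc k = nm u v w * nm u' v' w'"
    by simp_all
  then show ?case unfolding el_mult nm_mult[symmetric] by blast
qed

lemma nm_Ints: "u \<in> \<int> \<Longrightarrow> v \<in> \<int> \<Longrightarrow> w \<in> \<int> \<Longrightarrow> nm u v w \<in> \<int>"
  unfolding nm_def by (intro Ints_add Ints_diff Ints_mult Ints_power Ints_of_nat Ints_numeral) assumption+

lemma nm_scale: "nm (q * u) (q * v) (q * w) = q ^ 3 * nm u v w"
  by (simp add: nm_def power3_eq_cube algebra_simps)

text \<open>By multiplicativity the powers of the norm are norms of powers, and the norm is a cubic
  form, so \<open>N ^ 3\<close> clears the denominators of all of them.\<close>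

lemma almost_integral_nm:
  assumes "almost_integral (el u v w)"
  shows "nm u v w \<in> \<int>"
proof -
  obtain N :: int where N: "N \<noteq> 0" "\<And>k. of_int N * el u v w ^ k \<in> R"
    using assms unfolding almost_integral_def by blast
  have *: "of_int (N ^ 3) * nm u v w ^ k \<in> \<int>" for k
  proof -
    obtain u' v' w' where e: "el u v w ^ k = el u' v' w'" "nm u v w ^ k = nm u' v' w'"
      using el_power[of u v w k] by blast
    have "nm (of_int N * u') (of_int N * v') (of_int N * w') \<in> \<int>"
      using N(2)[of k] unfolding e(1) el_scale_int el_in_R_iff by (intro nm_Ints) auto
    then show ?thesis unfolding nm_scale e(2) of_int_power .
  qed
  show ?thesis by (rule rat_power_bounded_denom_imp_int[OF _ *]) (simp add: N(1))
qed

text \<open>The second elementary symmetric function of the conjugates, which is the linear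
  coefficient of the characteristic polynomial.\<close>

definition tr2 :: "rat \<Rightarrow> rat \<Rightarrow> rat \<Rightarrow> rat" where
  "tr2 u v w = 3 * u ^ 2 - 3 * of_nat (a * b) * v * w"

text \<open>Up to sign, the norm of \<open>x + t\<close> is the value of the characteristic
  polynomial of \<open>x\<close> at \<open>-t\<close>, so integral norms give integral
  values.\<close>

lemma nm_shift: "nm (u + t) v w = t ^ 3 + 3 * u * t ^ 2 + tr2 u v w * t + nm u v w"
  by (simp add: nm_def tr2_def power3_eq_cube power2_eq_square algebra_simps)

lemma almost_integral_half_trace:
  assumes "almost_integral (el u v w)"
  shows "6 * u \<in> \<int>" "2 * tr2 u v w \<in> \<int>" "3 * u + tr2 u v w \<in> \<int>"
proof -
  have N: "nm (u + of_int t) v w \<in> \<int>" for t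
  proof (rule almost_integral_nm)
    have "almost_integral (el u v w + of_int t)"
      by (intro almost_integral_add assms almost_integral_R R_int)
    then show "almost_integral (el (u + of_int t) v w)" by (simp add: el_int el_add)
  qed
  have 0: "nm u v w \<in> \<int>" using N[of 0] by simp
  have 1: "1 + 3 * u + tr2 u v w + nm u v w \<in> \<int>" using N[of 1] by (simp add: nm_shift)
  have "3 * u + (nm u v w - 1) - tr2 u v w = nm (u + of_int (- 1)) v w"
    unfolding nm_shift by simp
  then have 2: "3 * u + (nm u v w - 1) - tr2 u v w \<in> \<int>" by (simp only: N)
  \<comment> \<open>Sum and difference of the values at 1 and -1 separate the even from the odd
    coefficients, at the cost of a factor 2.\<close>
  have "(1 + 3 * u + tr2 u v w + nm u v w) + (3 * u + (nm u v w - 1) - tr2 u v w) - 2 * nm u v w \<in> \<int>"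
    by (intro Ints_add[OF 1 2] Ints_diff Ints_mult Ints_numeral 0)
  then show "6 * u \<in> \<int>" by (simp add: algebra_simps)
  have "(1 + 3 * u + tr2 u v w + nm u v w) - (3 * u + (nm u v w - 1) - tr2 u v w) - 2 \<in> \<int>"
    by (intro Ints_diff Ints_numeral 1 2)
  then show "2 * tr2 u v w \<in> \<int>" by (simp add: algebra_simps)
  have "(1 + 3 * u + tr2 u v w + nm u v w) - nm u v w - 1 \<in> \<int>"
    by (intro Ints_diff Ints_1 0 1)
  then show "3 * u + tr2 u v w \<in> \<int>" by simp
qed

text \<open>Integer values of the characteristic polynomial only bound the denominator of the trace
  \<open>T\<close> by 2; the same bound for the square, whose trace is \<open>T\<^sup>2 - 2 S\<close>, removes the 2.\<close>

lemma almost_integral_trace: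
  assumes "almost_integral (el u v w)"
  shows "3 * u \<in> \<int>"
proof -
  note h = almost_integral_half_trace[OF assms]
  have "almost_integral (el u v w * el u v w)" by (intro almost_integral_mult assms)
  then have "6 * (u * u + of_nat (a * b) * (v * w + w * v)) \<in> \<int>"
    unfolding el_mult by (rule almost_integral_half_trace)
  then have "6 * (u * u + of_nat (a * b) * (v * w + w * v)) + 2 * (2 * tr2 u v w) \<in> \<int>"
    by (intro Ints_add Ints_mult[of 2] Ints_numeral h)
  then have sq: "2 * (3 * u) ^ 2 \<in> \<int>" by (simp add: tr2_def power2_eq_square algebra_simps)
  obtain t where t: "6 * u = of_int t" using h(1) by (elim Ints_cases)
  obtain s where s: "2 * (3 * u) ^ 2 = of_int s" using sq by (elim Ints_cases)
  have "(of_int (t ^ 2) :: rat) = of_int (2 * s)"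
    unfolding of_int_power of_int_mult t[symmetric] s[symmetric] by (simp add: power2_eq_square)
  then have "t ^ 2 = 2 * s" by (simp only: of_int_eq_iff)
  then have "even t" by (metis dvd_triv_left even_power pos2)
  then obtain r where "t = 2 * r" by blast
  then have "3 * u = of_int r" using t by simp
  then show ?thesis by simp
qed

lemma almost_integral_tr2:
  assumes "almost_integral (el u v w)"
  shows "tr2 u v w \<in> \<int>"
  using Ints_diff[OF almost_integral_half_trace(3)[OF assms] almost_integral_trace[OF assms]]
  by simp

text \<open>With \<open>x = el u v w\<close>, trace \<open>T\<close> and second trace
  \<open>S\<close>, the product of the other two conjugates is \<open>x ^ 2 - T * x + S\<close>.
  Inserted into \<open>el_cofactor\<close>, this makes \<open>x\<close> a root of its characteristic
  polynomial.\<close>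

lemma el_cofactor_eq:
  "el (u ^ 2 - of_nat (a * b) * v * w) (of_nat a * w ^ 2 - u * v) (of_nat b * v ^ 2 - u * w)
     = el u v w * el u v w - of_rat (3 * u) * el u v w + of_rat (tr2 u v w)"
  unfolding el_scale el_mult el_diff el_rat el_add el_eq_iff
  by (simp add: tr2_def power2_eq_square algebra_simps)

lemma char_poly_root:
  "el u v w ^ 3 - of_rat (3 * u) * el u v w ^ 2 + of_rat (tr2 u v w) * el u v w - of_rat (nm u v w) = 0"
  using el_cofactor[of u v w] unfolding el_cofactor_eq
  by (simp add: power2_eq_square power3_eq_cube algebra_simps)

lemma algebraic_intI:
  assumes "3 * u \<in> \<int>" "tr2 u v w \<in> \<int>" "nm u v w \<in> \<int>"
  shows "algebraic_int (el u v w)"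
proof -
  obtain T S N where e: "3 * u = of_int T" "tr2 u v w = of_int S" "nm u v w = of_int N"
    using assms unfolding Ints_def by blast
  show ?thesis
  proof (rule algebraic_int.intros)
    let ?p = "[:- of_int N, of_int S, - of_int T, 1:] :: 'a poly"
    show "lead_coeff ?p = 1" by simp
    show "\<forall>i. coeff ?p i \<in> \<int>" by (auto simp: coeff_pCons split: nat.splits)
    show "poly ?p (el u v w) = 0"
      using char_poly_root[of u v w] unfolding e of_rat_of_int_eq
      by (simp add: power2_eq_square power3_eq_cube algebra_simps)
  qed
qed

lemma algebraic_int_el_iff_almost_integral:
  "algebraic_int (el u v w) \<longleftrightarrow> almost_integral (el u v w)"
proof
  have "el u v w \<in> K" using K_eq by blast
  then show "algebraic_int (el u v w) \<Longrightarrow> almost_integral (el u v w)"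
    by (rule algebraic_int_imp_almost_integral)
  show "almost_integral (el u v w) \<Longrightarrow> algebraic_int (el u v w)"
    by (intro algebraic_intI almost_integral_trace almost_integral_tr2 almost_integral_nm)
qed

lemma algebraic_int_el_iff:
  "algebraic_int (el u v w) \<longleftrightarrow> 3 * u \<in> \<int> \<and> tr2 u v w \<in> \<int> \<and> nm u v w \<in> \<int>"
  using algebraic_intI algebraic_int_el_iff_almost_integral almost_integral_trace
    almost_integral_tr2 almost_integral_nm by blast

end

section \<open>The ring of integers\<close>

text \<open>For the element \<open>(U + V * \<alpha> + W * \<beta>) / 3\<close> the second trace is
  \<open>trace2_form\<close> over 3 and the norm is \<open>norm_form\<close> over 27; integrality
  thus becomes a pair of divisibilities.\<close>

definition trace2_form :: "int \<Rightarrow> int \<Rightarrow> int \<Rightarrow> int \<Rightarrow> int \<Rightarrow> int" where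
  "trace2_form a b U V W = U ^ 2 - a * b * V * W"

definition norm_form :: "int \<Rightarrow> int \<Rightarrow> int \<Rightarrow> int \<Rightarrow> int \<Rightarrow> int" where
  "norm_form a b U V W = U ^ 3 + a * b ^ 2 * V ^ 3 + a ^ 2 * b * W ^ 3 - 3 * a * b * U * V * W"

section \<open>Congruences for the two forms modulo 3 and 27\<close>

lemma prime_3_int: "prime (3 :: int)"
  by simp

lemma not_3_dvd_cases:
  assumes "\<not> 3 dvd (x :: int)"
  obtains \<delta> k where "\<delta> = 1 \<or> \<delta> = -1" "x = \<delta> + 3 * k"
proof -
  have "x mod 3 = 1 \<or> x mod 3 = 2" using assms by presburger
  then show ?thesis
  proof
    assume "x mod 3 = 1"
    then have "x = 1 + 3 * (x div 3)" by presburger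
    then show ?thesis by (intro that[of 1 "x div 3"]) simp_all
  next
    assume "x mod 3 = 2"
    then have "x = - 1 + 3 * (x div 3 + 1)" by presburger
    then show ?thesis by (intro that[of "- 1" "x div 3 + 1"]) simp_all
  qed
qed

lemma square_cong_1_mod_3:
  assumes "\<not> 3 dvd (x :: int)"
  obtains j where "x ^ 2 = 1 + 3 * j"
proof -
  obtain \<delta> k where "\<delta> = 1 \<or> \<delta> = -1" "x = \<delta> + 3 * k" using not_3_dvd_cases[OF assms] .
  then have "x ^ 2 = 1 + 3 * (2 * \<delta> * k + 3 * k ^ 2)" by (auto simp: power2_eq_square algebra_simps)
  then show ?thesis by (rule that)
qed

lemma cube_cong_self_mod_3: "[(x :: int) ^ 3 = x] (mod 3)"
proof (cases "3 dvd x")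
  case True
  then have "3 dvd x ^ 3 - x" by (simp add: power3_eq_cube)
  then show ?thesis by (simp add: cong_iff_dvd_diff)
next
  case False
  then obtain j where "x ^ 2 = 1 + 3 * j" by (rule square_cong_1_mod_3)
  then have "x ^ 3 - x = 3 * (j * x)" by (simp add: power3_eq_cube power2_eq_square algebra_simps)
  then show ?thesis unfolding cong_iff_dvd_diff by simp
qed

text \<open>In the variables \<open>U\<close>, \<open>y = \<epsilon> * b * V\<close>,
  \<open>z = b * W\<close> the conditions modulo 3 read \<open>U + y + z = 0\<close> and
  \<open>U ^ 2 = y * z\<close>. They force \<open>(y - z) ^ 2 = 0\<close>, so all three variables
  agree modulo 3.\<close>

lemma forms_mod_3:
  assumes e: "\<epsilon> = 1 \<or> \<epsilon> = (-1::int)" and a: "[a = \<epsilon> * b] (mod 3)" and b: "\<not> 3 dvd b"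
    and t: "3 dvd trace2_form a b U V W" and n: "3 dvd norm_form a b U V W"
  shows "3 dvd V - \<epsilon> * b * U \<and> 3 dvd W - b * U"
proof -
  obtain j where "b ^ 2 = 1 + 3 * j" using square_cong_1_mod_3[OF b] .
  then have b2: "[b ^ 2 = 1] (mod 3)" by (simp add: cong_iff_dvd_diff)
  have ee: "\<epsilon> * \<epsilon> = 1" using e by auto
  have a2: "[a ^ 2 = 1] (mod 3)"
  proof -
    have "[a ^ 2 = (\<epsilon> * b) ^ 2] (mod 3)" using a by (rule cong_pow)
    also have "(\<epsilon> * b) ^ 2 = b ^ 2" using ee by (simp add: power2_eq_square algebra_simps)
    also note b2
    finally show ?thesis .
  qed
  define y z where "y = \<epsilon> * b * V" and "z = b * W"
  have s: "3 dvd U + y + z"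
  proof -
    have "[a * b ^ 2 * V ^ 3 = (\<epsilon> * b) * 1 * V] (mod 3)" by (intro cong_mult a b2 cube_cong_self_mod_3)
    moreover have "[a ^ 2 * b * W ^ 3 = 1 * b * W] (mod 3)"
      by (intro cong_mult a2 cong_refl cube_cong_self_mod_3)
    moreover have "[3 * a * b * U * V * W = 0] (mod 3)" by (simp add: cong_iff_dvd_diff)
    ultimately have "[norm_form a b U V W = U + (\<epsilon> * b) * 1 * V + 1 * b * W - 0] (mod 3)"
      unfolding norm_form_def by (intro cong_diff cong_add cube_cong_self_mod_3)
    then show ?thesis using n by (simp add: cong_dvd_iff y_def z_def)
  qed
  have q: "3 dvd U ^ 2 - y * z"
  proof -
    have "[a * b * V * W = (\<epsilon> * b) * b * V * W] (mod 3)" by (intro cong_mult a cong_refl)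
    then have "[trace2_form a b U V W = U ^ 2 - y * z] (mod 3)"
      unfolding trace2_form_def by (intro cong_diff) (auto simp: y_def z_def ac_simps)
    then show ?thesis using t by (simp add: cong_dvd_iff)
  qed
  \<comment> \<open>This is \<open>(y + z) ^ 2 - 4 * y * z\<close>, rearranged along the two known
    multiples of 3.\<close>
  have "(y - z) ^ 2 = (U + y + z) * (y + z - U) + 4 * (U ^ 2 - y * z) - 3 * U ^ 2"
    by (simp add: power2_eq_square algebra_simps)
  also have "3 dvd \<dots>" by (intro dvd_diff dvd_add dvd_mult2[OF s] dvd_mult[OF q] dvd_triv_left)
  finally have yz: "3 dvd y - z" using prime_3_int prime_dvd_power by blast
  have U1: "3 dvd y - U"
  proof -
    have "y - U = 3 * y - (U + y + z) - (y - z)" by simp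
    also have "3 dvd \<dots>" by (intro dvd_diff s yz dvd_triv_left)
    finally show ?thesis .
  qed
  have U2: "3 dvd z - U" using dvd_diff[OF U1 yz] by simp
  have "V - \<epsilon> * b * U = \<epsilon> * b * (y - U) - V * (b ^ 2 - 1)"
    using ee by (simp add: y_def power2_eq_square algebra_simps)
  moreover have "W - b * U = b * (z - U) - W * (b ^ 2 - 1)"
    by (simp add: z_def power2_eq_square algebra_simps)
  moreover have "3 dvd b ^ 2 - 1" using b2 by (simp add: cong_iff_dvd_diff)
  ultimately show ?thesis using U1 U2 by (metis dvd_diff dvd_mult)
qed

text \<open>Since \<open>b ^ 2\<close> is 1 modulo 3, every term of the expansion except
  \<open>9 * (k ^ 2 * b ^ 4)\<close> is a multiple of 27. This is the origin of the modulus 9 in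
  Type II.\<close>

lemma norm_form_special:
  assumes e: "\<epsilon> = 1 \<or> \<epsilon> = (-1::int)" and a: "a = \<epsilon> * b + 3 * k" and b: "\<not> 3 dvd b"
  shows "27 dvd norm_form a b 1 (\<epsilon> * b) b \<longleftrightarrow> 3 dvd k"
proof -
  obtain j where j: "b ^ 2 = 1 + 3 * j" using square_cong_1_mod_3[OF b] .
  have "norm_form a b 1 (\<epsilon> * b) b
      = (1 - b ^ 2) ^ 2 * (1 + 2 * b ^ 2) + 9 * k * \<epsilon> * b ^ 3 * (b ^ 2 - 1) + 9 * (k ^ 2 * b ^ 4)"
    using e unfolding norm_form_def a
    by (auto simp: power2_eq_square power3_eq_cube power4_eq_xxxx algebra_simps)
  also have "\<dots> = 27 * (j ^ 2 * (1 + 2 * j) + k * \<epsilon> * b ^ 3 * j) + 9 * (k ^ 2 * b ^ 4)"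
    unfolding j by (simp add: power2_eq_square algebra_simps)
  finally have "27 dvd norm_form a b 1 (\<epsilon> * b) b \<longleftrightarrow> 27 dvd 9 * (k ^ 2 * b ^ 4)"
    by (simp add: dvd_add_right_iff)
  also have "\<dots> \<longleftrightarrow> 3 dvd k ^ 2 * b ^ 4"
    using dvd_mult_cancel_left[of 9 3 "k ^ 2 * b ^ 4"] by simp
  also have "\<dots> \<longleftrightarrow> 3 dvd k"
    using b prime_3_int by (metis prime_dvd_mult_iff prime_dvd_power_iff zero_less_numeral)
  finally show ?thesis .
qed

text \<open>The exponents of 3 in \<open>U ^ 3\<close>, \<open>a * b ^ 2 * V ^ 3\<close> and
  \<open>a ^ 2 * b * W ^ 3\<close> are 0, 1 and 2 modulo 3, so these terms cannot cancel, and
  divisibility passes from \<open>U\<close> to \<open>V\<close> to \<open>W\<close>.\<close>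

lemma forms_ramified:
  fixes a b U V W :: int
  assumes a: "3 dvd a" "\<not> 9 dvd a" and b: "\<not> 3 dvd b"
    and t: "3 dvd trace2_form a b U V W" and n: "27 dvd norm_form a b U V W"
  shows "3 dvd U \<and> 3 dvd V \<and> 3 dvd W"
proof -
  obtain c where c: "a = 3 * c" using a(1) by blast
  have nc: "\<not> 3 dvd c" using a(2) c by auto
  have p: "3 dvd x \<or> 3 dvd y" if "3 dvd x * y" for x y :: int
    using that prime_3_int by (simp add: prime_dvd_mult_iff)
  have pp: "3 dvd x" if "3 dvd x ^ k" for x :: int and k
    using that prime_3_int prime_dvd_power by blast
  have "U ^ 2 = trace2_form a b U V W + 3 * (c * b * V * W)" by (simp add: trace2_form_def c)
  also have "3 dvd \<dots>" using t by simp
  finally have U: "3 dvd U" by (rule pp)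
  then obtain U' where U': "U = 3 * U'" by blast
  have "norm_form a b U V W = 27 * (U' ^ 3 - c * b * U' * V * W) + 3 * (c * b ^ 2 * V ^ 3 + 3 * (c ^ 2 * b * W ^ 3))"
    by (simp add: norm_form_def c U' power2_eq_square power3_eq_cube algebra_simps)
  then have "27 dvd 3 * (c * b ^ 2 * V ^ 3 + 3 * (c ^ 2 * b * W ^ 3))"
    using n by (simp add: dvd_add_right_iff)
  then have 9: "9 dvd c * b ^ 2 * V ^ 3 + 3 * (c ^ 2 * b * W ^ 3)"
    by presburger
  then have "3 dvd c * b ^ 2 * V ^ 3" by presburger
  then have V: "3 dvd V" using p pp nc b by blast
  then obtain V' where V': "V = 3 * V'" by blast
  have "c * b ^ 2 * V ^ 3 + 3 * (c ^ 2 * b * W ^ 3) = 9 * (3 * c * b ^ 2 * V' ^ 3) + 3 * (c ^ 2 * b * W ^ 3)"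
    by (simp add: V' power3_eq_cube algebra_simps)
  then have "9 dvd 3 * (c ^ 2 * b * W ^ 3)" using 9 by presburger
  then have "3 dvd c ^ 2 * b * W ^ 3" by presburger
  then have "3 dvd W" using p pp nc b by blast
  then show ?thesis using U V by blast
qed

text \<open>Exchanging \<open>a\<close> and \<open>b\<close> exchanges \<alpha> and \<beta>; the
  case of 3 dividing \<open>b\<close> thereby reduces to that of 3 dividing
  \<open>a\<close>.\<close>

lemma forms_swap:
  "trace2_form a b U V W = trace2_form b a U W V" "norm_form a b U V W = norm_form b a U W V"
  by (simp_all add: trace2_form_def norm_form_def algebra_simps)

lemma squarefree_dvd_cubic_form:
  fixes a b :: nat and V W :: int
  assumes sq: "squarefree a" and cop: "coprime a b"
    and d: "int a ^ 2 dvd int b * V ^ 3 + int a * W ^ 3"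
  shows "int a dvd V \<and> int a dvd W"
proof -
  have nz: "int a \<noteq> 0" using sq by (metis not_squarefree_0 of_nat_eq_0_iff)
  have "int a dvd int b * V ^ 3 + int a * W ^ 3" using d by (metis dvd_trans dvd_triv_left power2_eq_square)
  then have "int a dvd int b * V ^ 3" by (simp add: dvd_add_left_iff)
  then have "int a dvd V ^ 3" using cop by (simp add: coprime_dvd_mult_right_iff)
  then have V: "int a dvd V" using sq squarefree_dvd_power by blast
  then obtain X where X: "V = int a * X" by blast
  have "int b * V ^ 3 + int a * W ^ 3 = int a ^ 2 * (int b * int a * X ^ 3) + int a * W ^ 3"
    by (simp add: X power2_eq_square power3_eq_cube algebra_simps)
  then have "int a ^ 2 dvd int a * W ^ 3" using d by (simp only: dvd_add_right_iff dvd_triv_left)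
  then have "int a dvd W ^ 3" using nz by (simp add: power2_eq_square)
  then show ?thesis using V sq squarefree_dvd_power by blast
qed

section \<open>Integral bases in the two types\<close>

context pure_cubic
begin

text \<open>The traces of \<open>\<beta> * x\<close> and \<open>\<alpha> * x\<close> are
  \<open>V = 3 * a * b * v\<close> and \<open>W = 3 * a * b * w\<close>. Subtracting the trace from
  \<open>3 * x\<close> leaves \<open>3 * v * \<alpha> + 3 * w * \<beta>\<close>, whose integral norm
  says that \<open>a ^ 2 * b ^ 2\<close> divides \<open>b * V ^ 3 + a * W ^ 3\<close>.
  Squarefreeness then makes \<open>V\<close> and \<open>W\<close> multiples of
  \<open>a * b\<close>.\<close>

lemma algebraic_int_imp_third:
  assumes "algebraic_int (el u v w)"
  shows "3 * v \<in> \<int> \<and> 3 * w \<in> \<int>"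
proof -
  have x: "almost_integral (el u v w)" using assms algebraic_int_el_iff_almost_integral by blast
  have R: "el 0 1 0 \<in> R" "el 0 0 1 \<in> R" "el 3 0 0 \<in> R" "el (- 3 * u) 0 0 \<in> R"
    using almost_integral_trace[OF x] by (auto simp: el_in_R_iff minus_in_Ints_iff)
  have "3 * (of_nat (a * b) * w) \<in> \<int>" "3 * (of_nat (a * b) * v) \<in> \<int>"
    using almost_integral_trace[OF almost_integral_mult[OF almost_integral_R[OF R(1)] x, unfolded el_mult]]
      almost_integral_trace[OF almost_integral_mult[OF almost_integral_R[OF R(2)] x, unfolded el_mult]]
    by simp_all
  then obtain V W :: int where V: "3 * (of_nat (a * b) * v) = of_int V" and W: "3 * (of_nat (a * b) * w) = of_int W"
    unfolding Ints_def by blast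
  have "almost_integral (el 3 0 0 * el u v w + el (- 3 * u) 0 0)"
    by (intro almost_integral_add almost_integral_mult x almost_integral_R R)
  then have "nm 0 (3 * v) (3 * w) \<in> \<int>"
    unfolding el_mult el_add by (intro almost_integral_nm) simp
  then obtain n where n: "nm 0 (3 * v) (3 * w) = of_int n" by (elim Ints_cases)
  have nz: "(of_nat a :: rat) \<noteq> 0" "(of_nat b :: rat) \<noteq> 0" using a_pos b_pos by simp_all
  have v: "3 * v = of_int V / (of_nat a * of_nat b)" and w: "3 * w = of_int W / (of_nat a * of_nat b)"
    using V W nz by (simp_all add: field_simps)
  have "(of_int (int b * V ^ 3 + int a * W ^ 3) :: rat) = of_int (n * (int a ^ 2 * int b ^ 2))"
    using n nz unfolding nm_def v w
    by (simp add: field_simps power2_eq_square power3_eq_cube)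
  then have e: "int b * V ^ 3 + int a * W ^ 3 = n * (int a ^ 2 * int b ^ 2)" by (simp only: of_int_eq_iff)
  have "int a dvd V \<and> int a dvd W"
    using sqf_a cop by (intro squarefree_dvd_cubic_form[of a b]) (simp_all add: e)
  moreover have "int b dvd W \<and> int b dvd V"
    using sqf_b cop e by (intro squarefree_dvd_cubic_form[of b a]) (simp_all add: add.commute coprime_commute)
  moreover have "coprime (int a) (int b)" using cop by simp
  ultimately have "int a * int b dvd V" "int a * int b dvd W" by (simp_all add: divides_mult)
  then obtain V' W' where "V = int a * int b * V'" "W = int a * int b * W'" by blast
  then have "3 * v = of_int V'" "3 * w = of_int W'" using v w nz by simp_all
  then show ?thesis by simp
qed

lemma algebraic_int_third_iff:
  "algebraic_int (el (of_int U / 3) (of_int V / 3) (of_int W / 3)) \<longleftrightarrow>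
     3 dvd trace2_form (int a) (int b) U V W \<and> 27 dvd norm_form (int a) (int b) U V W"
proof -
  have "tr2 (of_int U / 3) (of_int V / 3) (of_int W / 3) = of_int (trace2_form (int a) (int b) U V W) / of_int 3"
    by (simp add: tr2_def trace2_form_def field_simps power2_eq_square)
  moreover have "nm (of_int U / 3) (of_int V / 3) (of_int W / 3) = of_int (norm_form (int a) (int b) U V W) / of_int 27"
    by (simp add: nm_def norm_form_def field_simps power2_eq_square power3_eq_cube)
  ultimately show ?thesis
    unfolding algebraic_int_el_iff by (simp only: of_int_div_of_int_in_Ints_iff) simp
qed

lemma algebraic_int_el_cases:
  assumes "algebraic_int (el u v w)"
  obtains U V W where "u = of_int U / 3" "v = of_int V / 3" "w = of_int W / 3"
    "3 dvd trace2_form (int a) (int b) U V W" "27 dvd norm_form (int a) (int b) U V W"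
proof -
  have "3 * u \<in> \<int>" "3 * v \<in> \<int>" "3 * w \<in> \<int>"
    using assms algebraic_int_el_iff algebraic_int_imp_third by blast+
  then obtain U V W where "3 * u = of_int U" "3 * v = of_int V" "3 * w = of_int W"
    unfolding Ints_def by blast
  then have "u = of_int U / 3" "v = of_int V / 3" "w = of_int W / 3" by simp_all
  with that assms algebraic_int_third_iff show ?thesis by metis
qed

text \<open>Type I in terms of the locale parameters, since \<open>type_I\<close> refers to a
  definite description whose uniqueness is shown later; \<open>type_II_iff\<close> connects the
  two.\<close>

definition wild :: bool where
  "wild \<longleftrightarrow> 3 dvd a * b ^ 2 \<or> \<not> ([int a = int b] (mod 9) \<or> [int a = - int b] (mod 9))"

lemma algebraic_int_wild_iff:
  assumes wild
  shows "algebraic_int (el u v w) \<longleftrightarrow> u \<in> \<int> \<and> v \<in> \<int> \<and> w \<in> \<int>"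
proof
  assume "u \<in> \<int> \<and> v \<in> \<int> \<and> w \<in> \<int>"
  then show "algebraic_int (el u v w)"
    by (simp add: algebraic_int_el_iff_almost_integral almost_integral_R el_in_R_iff)
next
  assume int: "algebraic_int (el u v w)"
  then obtain U V W where uvw: "u = of_int U / 3" "v = of_int V / 3" "w = of_int W / 3"
    and t: "3 dvd trace2_form (int a) (int b) U V W" and n: "27 dvd norm_form (int a) (int b) U V W"
    by (rule algebraic_int_el_cases)
  have sq9: "\<not> 9 dvd int c" if "squarefree c" for c :: nat
  proof
    assume "9 dvd int c"
    then have "3 ^ 2 dvd c" using of_nat_dvd_iff[of 9 c, where ?'a = int] by simp
    then show False using that squarefreeD[of c 3] by simp
  qed
  have n3: "\<not> (3 dvd a \<and> 3 dvd b)" using cop by (metis coprime_common_divisor_nat numeral_One numeral_eq_iff semiring_norm(84))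
  have "3 dvd U \<and> 3 dvd V \<and> 3 dvd W"
  proof (cases "3 dvd a")
    case True
    then have "3 dvd int a" "\<not> 3 dvd int b" using n3 of_nat_dvd_iff[of 3] by auto
    then show ?thesis using forms_ramified[OF _ sq9[OF sqf_a] _ t n] by blast
  next
    case na: False
    show ?thesis
    proof (cases "3 dvd b")
      case True
      then have "3 dvd int b" "\<not> 3 dvd int a" using n3 of_nat_dvd_iff[of 3] by auto
      then show ?thesis using forms_ramified[OF _ sq9[OF sqf_b] _ t[unfolded forms_swap(1)[of "int a"]] n[unfolded forms_swap(2)[of "int a"]]]
        by blast
    next
      case nb: False
      have 3: "\<not> 3 dvd int a" "\<not> 3 dvd int b" using na nb of_nat_dvd_iff[of 3] by auto
      then obtain \<epsilon> k where e: "\<epsilon> = 1 \<or> \<epsilon> = -1" and k: "int a = \<epsilon> * int b + 3 * k"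
      proof -
        assume *: "\<And>\<epsilon> k. \<epsilon> = 1 \<or> \<epsilon> = - 1 \<Longrightarrow> int a = \<epsilon> * int b + 3 * k \<Longrightarrow> thesis"
        obtain s i where s: "s = 1 \<or> s = -1" "int a = s + 3 * i" using not_3_dvd_cases[OF 3(1)] .
        obtain r j where r: "r = 1 \<or> r = -1" "int b = r + 3 * j" using not_3_dvd_cases[OF 3(2)] .
        have "int a = s * r * int b + 3 * (i - s * r * j)" using s r by (auto simp: algebra_simps)
        then show thesis using s(1) r(1) by (intro *[of "s * r" "i - s * r * j"]) auto
      qed
      have cong: "[int a = \<epsilon> * int b] (mod 3)" by (simp add: k cong_iff_dvd_diff)
      have "3 dvd norm_form (int a) (int b) U V W" by (rule dvd_trans[OF _ n]) simp
      with forms_mod_3[OF e cong 3(2) t]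
      obtain V' W' where VW: "V - \<epsilon> * int b * U = 3 * V'" "W - int b * U = 3 * W'" by blast
      have "3 dvd U"
      proof (rule ccontr)
        assume "\<not> 3 dvd U"
        then obtain \<delta> U' where d: "\<delta> = 1 \<or> \<delta> = -1" and U: "U = \<delta> + 3 * U'" by (rule not_3_dvd_cases)
        \<comment> \<open>Adding this element of \<open>R\<close> reduces \<open>U\<close> to its
          residue \<delta> modulo 3 and the other coordinates accordingly. Multiplying by \<delta>
          then yields \<open>(1 + \<epsilon> * b * \<alpha> + b * \<beta>) / 3\<close>.\<close>
        let ?y = "el (of_int (- U')) (of_int (- V' - \<epsilon> * int b * U')) (of_int (- W' - int b * U'))"
        have "almost_integral (el u v w)" using int algebraic_int_el_iff_almost_integral by blast
        then have "almost_integral (of_int \<delta> * (el u v w + ?y))"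
          by (rule almost_integral_mult[OF almost_integral_R[OF R_int]
                almost_integral_add[OF _ almost_integral_R[OF el_in_R]]])
        moreover have "of_int \<delta> * (el u v w + ?y) = el (of_int 1 / 3) (of_int (\<epsilon> * int b) / 3) (of_int (int b) / 3)"
        proof -
          have V: "V = \<epsilon> * int b * U + 3 * V'" "W = int b * U + 3 * W'" using VW by auto
          have dd: "\<delta> * \<delta> = 1" using d by auto
          then have dd': "(of_int \<delta> :: rat) * of_int \<delta> = 1" by (metis of_int_1 of_int_mult)
          show ?thesis
            unfolding uvw el_add el_scale_int el_eq_iff V U
            using d by (auto simp: field_simps)
        qed
        ultimately have "27 dvd norm_form (int a) (int b) 1 (\<epsilon> * int b) (int b)"
          using algebraic_int_third_iff algebraic_int_el_iff_almost_integral by metis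
        then have "3 dvd k" using norm_form_special[OF e k 3(2)] by blast
        then obtain l where "k = 3 * l" by blast
        then have "int a = \<epsilon> * int b + 9 * l" using k by simp
        then have "[int a = \<epsilon> * int b] (mod 9)" by (simp add: cong_iff_dvd_diff)
        then have "[int a = int b] (mod 9) \<or> [int a = - int b] (mod 9)" using e by auto
        moreover have "\<not> 3 dvd a * b ^ 2"
          using na nb by (simp add: prime_dvd_mult_iff prime_dvd_power_iff)
        ultimately show False using assms unfolding wild_def by blast
      qed
      moreover have V: "V = \<epsilon> * int b * U + 3 * V'" "W = int b * U + 3 * W'" using VW by auto
      ultimately show ?thesis by simp
    qed
  qed
  then obtain U' V' W' where "U = 3 * U'" "V = 3 * V'" "W = 3 * W'" by blast
  then show "u \<in> \<int> \<and> v \<in> \<int> \<and> w \<in> \<int>" using uvw by simp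
qed

lemma not_wild_sign:
  assumes "\<not> wild"
  obtains \<epsilon> :: int where "\<epsilon> = 1 \<or> \<epsilon> = -1" "[int a = \<epsilon> * int b] (mod 9)" "\<not> 3 dvd int b"
proof -
  have "\<not> 3 dvd a * b ^ 2" using assms by (simp add: wild_def)
  then have "\<not> 3 dvd b" by (metis dvd_mult dvd_mult2 power2_eq_square)
  then have "\<not> 3 dvd int b" using of_nat_dvd_iff[of 3 b] by simp
  moreover have "[int a = 1 * int b] (mod 9) \<or> [int a = -1 * int b] (mod 9)"
    using assms by (simp add: wild_def)
  ultimately show ?thesis using that by blast
qed

text \<open>The integers \<open>p\<close>, \<open>q\<close>, \<open>r\<close> are the coordinates in
  the basis \<open>?g\<close>, \<alpha>, \<beta>, where \<open>?g\<close> is the special element of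
  \<open>norm_form_special\<close>.\<close>

lemma algebraic_int_tame_iff:
  assumes e: "\<epsilon> = 1 \<or> \<epsilon> = (-1::int)" and cong: "[int a = \<epsilon> * int b] (mod 9)" and b: "\<not> 3 dvd int b"
  shows "algebraic_int (el u v w) \<longleftrightarrow>
    (\<exists>p q r :: int. u = of_int p / 3 \<and> v = of_int q + of_int (p * \<epsilon> * int b) / 3
        \<and> w = of_int r + of_int (p * int b) / 3)"
proof
  assume "algebraic_int (el u v w)"
  then obtain U V W where uvw: "u = of_int U / 3" "v = of_int V / 3" "w = of_int W / 3"
    and t: "3 dvd trace2_form (int a) (int b) U V W" and n: "27 dvd norm_form (int a) (int b) U V W"
    by (rule algebraic_int_el_cases)
  have "3 dvd norm_form (int a) (int b) U V W" by (rule dvd_trans[OF _ n]) simp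
  moreover have "[int a = \<epsilon> * int b] (mod 3)" using cong by (rule cong_dvd_modulus) simp
  ultimately obtain V' W' where "V - \<epsilon> * int b * U = 3 * V'" "W - int b * U = 3 * W'"
    using forms_mod_3[OF e _ b t] by blast
  then have "V = 3 * V' + \<epsilon> * int b * U" "W = 3 * W' + int b * U" by auto
  then show "\<exists>p q r :: int. u = of_int p / 3 \<and> v = of_int q + of_int (p * \<epsilon> * int b) / 3
        \<and> w = of_int r + of_int (p * int b) / 3"
    using uvw by (intro exI[of _ U] exI[of _ V'] exI[of _ W']) (simp add: field_simps)
next
  assume "\<exists>p q r :: int. u = of_int p / 3 \<and> v = of_int q + of_int (p * \<epsilon> * int b) / 3
        \<and> w = of_int r + of_int (p * int b) / 3"
  then obtain p q r :: int where pqr: "u = of_int p / 3" "v = of_int q + of_int (p * \<epsilon> * int b) / 3"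
        "w = of_int r + of_int (p * int b) / 3" by blast
  let ?g = "el (of_int 1 / 3) (of_int (\<epsilon> * int b) / 3) (of_int (int b) / 3)"
  obtain k where k: "int a = \<epsilon> * int b + 9 * k"
    using cong by (metis cong_iff_lin cong_sym mult.commute)
  have "27 dvd norm_form (int a) (int b) 1 (\<epsilon> * int b) (int b)"
    using norm_form_special[OF e _ b, of "int a" "3 * k"] k by simp
  moreover have "3 dvd trace2_form (int a) (int b) 1 (\<epsilon> * int b) (int b)"
  proof -
    obtain j where j: "int b ^ 2 = 1 + 3 * j" using square_cong_1_mod_3[OF b] .
    have "trace2_form (int a) (int b) 1 (\<epsilon> * int b) (int b) = 1 - (\<epsilon> * \<epsilon>) * (int b ^ 2) ^ 2 - 9 * k * \<epsilon> * int b ^ 3"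
      by (simp add: trace2_form_def k power2_eq_square power3_eq_cube algebra_simps)
    also have "\<dots> = 3 * (- 2 * j - 3 * j ^ 2 - 3 * k * \<epsilon> * int b ^ 3)"
      unfolding j using e by (auto simp: power2_eq_square algebra_simps)
    finally show ?thesis by simp
  qed
  ultimately have "almost_integral ?g"
    using algebraic_int_third_iff[of 1 "\<epsilon> * int b" "int b"] algebraic_int_el_iff_almost_integral by blast
  then have "almost_integral (of_int p * ?g + el (of_int 0) (of_int q) (of_int r))"
    by (rule almost_integral_add[OF almost_integral_mult[OF almost_integral_R[OF R_int]]
          almost_integral_R[OF el_in_R]])
  moreover have "of_int p * ?g + el (of_int 0) (of_int q) (of_int r) = el u v w"
    unfolding el_scale_int el_add el_eq_iff pqr by (simp add: algebra_simps)
  ultimately show "algebraic_int (el u v w)" by (simp only: algebraic_int_el_iff_almost_integral)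
qed

end

section \<open>Embeddings and the projected lattice\<close>

lemma of_real_of_rat: "(of_real (of_rat q) :: 'a :: {real_div_algebra, field_char_0}) = of_rat q"
proof -
  obtain c d where "q = of_int c / of_int d" by (metis quotient_of_div surj_pair)
  then show ?thesis by (simp add: of_rat_divide)
qed

context
  fixes F :: "'a::field_char_0 set" and \<sigma> :: "'a \<Rightarrow> complex"
  assumes F: "is_subfield F" and emb: "\<sigma> \<in> embeddings F"
begin

lemma embedding_1: "\<sigma> 1 = 1"
  and embedding_add: "x \<in> F \<Longrightarrow> y \<in> F \<Longrightarrow> \<sigma> (x + y) = \<sigma> x + \<sigma> y"
  and embedding_mult: "x \<in> F \<Longrightarrow> y \<in> F \<Longrightarrow> \<sigma> (x * y) = \<sigma> x * \<sigma> y"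
  using emb by (simp_all add: embeddings_def)

lemma embedding_0: "\<sigma> 0 = 0"
  using embedding_add[of 0 0] subfield_0[OF F] by simp

lemma embedding_of_int: "\<sigma> (of_int z) = of_int z"
proof -
  have in_F: "of_int n \<in> F" for n
    using is_subfield_of_rat[OF F, of "of_int n"] by simp
  have n: "\<sigma> (of_nat n) = of_nat n" for n
  proof (induction n)
    case (Suc n)
    have "\<sigma> (1 + of_nat n) = \<sigma> 1 + \<sigma> (of_nat n)"
      using in_F[of 1] in_F[of "int n"] by (intro embedding_add) simp_all
    then show ?case using Suc embedding_1 by simp
  qed (simp add: embedding_0)
  show ?thesis
  proof (cases z)
    case (nonneg k)
    then show ?thesis using n by simp
  next
    case (neg k)
    have "\<sigma> (of_int z + of_int (int (Suc k))) = \<sigma> (of_int z) + \<sigma> (of_int (int (Suc k)))"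
      by (intro embedding_add in_F)
    also have "of_int z + of_int (int (Suc k)) = (0 :: 'a)" unfolding neg by simp
    also have "\<sigma> (of_int (int (Suc k))) = of_nat (Suc k)" using n[of "Suc k"] by (simp only: of_int_of_nat_eq)
    finally have "\<sigma> (of_int z) = - of_nat (Suc k)" unfolding embedding_0 by (metis add_eq_0_iff2)
    then show ?thesis unfolding neg by simp
  qed
qed

lemma embedding_of_rat: "\<sigma> (of_rat q) = of_rat q"
proof -
  obtain c d :: int where q: "q = of_int c / of_int d" and d: "d > 0"
    by (metis quotient_of_denom_pos quotient_of_div surj_pair)
  have e: "(of_int d :: 'b::field_char_0) * of_rat q = of_int c"
    using d by (simp add: q of_rat_divide)
  have "of_int d \<in> F" using is_subfield_of_rat[OF F, of "of_int d"] by simp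
  then have "\<sigma> (of_int d * of_rat q) = of_int d * \<sigma> (of_rat q)"
    using embedding_mult is_subfield_of_rat[OF F] by (simp add: embedding_of_int)
  then have "of_int d * \<sigma> (of_rat q) = of_int d * of_rat q" unfolding e by (simp add: embedding_of_int)
  then show ?thesis using d by simp
qed

end

section \<open>Embeddings indexed by the cube roots of unity\<close>

context pure_cubic
begin

definition A :: real where "A = root 3 (of_nat (a * b ^ 2))"
definition B :: real where "B = root 3 (of_nat (a ^ 2 * b))"

lemma A_pos: "A > 0" and B_pos: "B > 0"
  using a_pos b_pos by (simp_all add: A_def B_def)

lemma A_cube: "A ^ 3 = of_nat (a * b ^ 2)"
  unfolding A_def by (rule real_root_pow_pos2) simp_all

lemma B_cube: "B ^ 3 = of_nat (a ^ 2 * b)"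
  unfolding B_def by (rule real_root_pow_pos2) simp_all

lemma cube_inj_real: "x \<ge> 0 \<Longrightarrow> y \<ge> 0 \<Longrightarrow> x ^ 3 = y ^ 3 \<Longrightarrow> x = (y :: real)"
  using power_eq_imp_eq_base[of x 3 y] by simp

lemma A_B: "A * B = of_nat (a * b)"
proof (rule cube_inj_real)
  show "(A * B) ^ 3 = of_nat (a * b) ^ 3"
    unfolding power_mult_distrib A_cube B_cube by (simp add: power2_eq_square power3_eq_cube)
qed (use A_pos B_pos in simp_all)

lemma A2: "A ^ 2 = of_nat b * B"
proof -
  have "A * A ^ 2 = of_nat b * (A * B)"
    using A_cube unfolding A_B by (simp add: power3_eq_cube power2_eq_square ac_simps)
  also have "\<dots> = A * (of_nat b * B)" by simp
  finally have "A * A ^ 2 = A * (of_nat b * B)" .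
  then show ?thesis using A_pos by simp
qed

lemma B2: "B ^ 2 = of_nat a * A"
proof -
  have "B * B ^ 2 = of_nat a * (A * B)"
    using B_cube unfolding A_B by (simp add: power3_eq_cube power2_eq_square ac_simps)
  also have "\<dots> = B * (of_nat a * A)" by simp
  finally have "B * B ^ 2 = B * (of_nat a * A)" .
  then show ?thesis using B_pos by simp
qed

lemma B_div_A: "B / A = root 3 (of_nat a / of_nat b)"
proof -
  have "root 3 (of_nat a / of_nat b) = root 3 (of_nat (a ^ 2 * b) / of_nat (a * b ^ 2))"
    using a_pos b_pos by (simp add: field_simps power2_eq_square)
  then show ?thesis by (simp add: A_def B_def real_root_divide)
qed

definition conj_val :: "complex \<Rightarrow> rat \<Rightarrow> rat \<Rightarrow> rat \<Rightarrow> complex" where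
  "conj_val c u v w = of_rat u + of_rat v * (c * of_real A) + of_rat w * (c ^ 2 * of_real B)"

lemma conj_val_mult:
  assumes "c ^ 3 = 1"
  shows "conj_val c u v w * conj_val c u' v' w'
    = conj_val c (u * u' + of_nat (a * b) * (v * w' + w * v'))
     (u * v' + v * u' + of_nat a * w * w') (u * w' + w * u' + of_nat b * v * v')"
  unfolding conj_val_def
proof (rule cubic_basis_mult)
  have "(c * of_real A) ^ 2 = c ^ 2 * of_real (A ^ 2)" by (simp add: power_mult_distrib)
  then show "(c * of_real A) ^ 2 = of_nat b * (c ^ 2 * of_real B)" unfolding A2 by simp
  have "(c ^ 2 * of_real B) ^ 2 = c ^ 3 * c * of_real (B ^ 2)"
    by (simp add: power2_eq_square power3_eq_cube)
  then show "(c ^ 2 * of_real B) ^ 2 = of_nat a * (c * of_real A)" unfolding B2 assms by simp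
  have "c * complex_of_real A * (c ^ 2 * complex_of_real B) = c ^ 3 * of_real (A * B)"
    by (simp add: power2_eq_square power3_eq_cube)
  then show "c * complex_of_real A * (c ^ 2 * complex_of_real B) = of_nat (a * b)"
    unfolding assms A_B by simp
qed

text \<open>The description is legitimate because coordinates are unique (\<open>el_eq_iff\<close>),
  and the restriction to \<open>K\<close> meets the convention that embeddings are
  extensional.\<close>

definition conj_emb :: "complex \<Rightarrow> 'a \<Rightarrow> complex" where
  "conj_emb c = restrict (\<lambda>x. THE z. \<exists>u v w. x = el u v w \<and> z = conj_val c u v w) K"

lemma el_in_K: "el u v w \<in> K"
  using K_eq by blast

lemma conj_emb_el: "conj_emb c (el u v w) = conj_val c u v w"
  unfolding conj_emb_def using el_in_K by (auto simp: el_eq_iff)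

lemma conj_emb_embedding:
  assumes "c ^ 3 = 1"
  shows "conj_emb c \<in> embeddings K"
  unfolding embeddings_def
proof (intro CollectI conjI ballI)
  show "conj_emb c \<in> extensional K" by (simp add: conj_emb_def)
  show "conj_emb c 1 = 1" unfolding el_1 conj_emb_el by (simp add: conj_val_def)
  fix x y assume "x \<in> K" "y \<in> K"
  then obtain u v w u' v' w' where xy: "x = el u v w" "y = el u' v' w'" unfolding K_eq by blast
  show "conj_emb c (x + y) = conj_emb c x + conj_emb c y"
    unfolding xy el_add conj_emb_el by (simp add: conj_val_def of_rat_add algebra_simps)
  show "conj_emb c (x * y) = conj_emb c x * conj_emb c y"
    unfolding xy el_mult conj_emb_el conj_val_mult[OF assms] by (rule refl)
qed

text \<open>An embedding fixes the rationals, so it sends \<alpha> to a cube root of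
  \<open>A ^ 3\<close>, that is, to \<open>c * A\<close> with \<open>c ^ 3 = 1\<close>; the image of
  \<beta> then follows from \<open>\<alpha> ^ 2 = b * \<beta>\<close>.\<close>

lemma embeddings_eq: "embeddings K = conj_emb ` {c. c ^ 3 = 1}"
proof (intro equalityI subsetI)
  fix \<sigma> assume s: "\<sigma> \<in> embeddings K"
  note F = K_subfield s
  define c where "c = \<sigma> \<alpha> / of_real A"
  have sa: "\<sigma> \<alpha> = c * of_real A" using A_pos by (simp add: c_def)
  have "\<sigma> (\<alpha> * (\<alpha> * \<alpha>)) = \<sigma> \<alpha> * (\<sigma> \<alpha> * \<sigma> \<alpha>)"
    using alpha_in_K subfield_mult[OF K_subfield] by (simp add: embedding_mult[OF F])
  moreover have "\<alpha> * (\<alpha> * \<alpha>) = of_int (int (a * b ^ 2))"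
    using alpha_cube by (simp add: power3_eq_cube mult.assoc)
  ultimately have "\<sigma> \<alpha> ^ 3 = of_int (int (a * b ^ 2))"
    by (simp only: embedding_of_int[OF F] power3_eq_cube mult.assoc)
  also have "\<dots> = of_real (A ^ 3)" by (simp add: A_cube)
  finally have "c ^ 3 = 1" using A_pos by (simp add: c_def power_divide)
  have "of_int (int b) \<in> K" using is_subfield_of_rat[OF K_subfield, of "of_int (int b)"] by simp
  then have "\<sigma> (of_int (int b) * \<beta>) = of_int (int b) * \<sigma> \<beta>"
    using beta_in_K by (simp only: embedding_mult[OF F] embedding_of_int[OF F])
  moreover have "of_int (int b) * \<beta> = \<alpha> * \<alpha>" using alpha2 by (simp add: power2_eq_square)
  ultimately have "of_nat b * \<sigma> \<beta> = \<sigma> \<alpha> * \<sigma> \<alpha>"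
    using alpha_in_K by (simp add: embedding_mult[OF F])
  also have "\<dots> = c ^ 2 * of_real (A ^ 2)" by (simp add: sa power2_eq_square)
  also have "\<dots> = of_nat b * (c ^ 2 * of_real B)" unfolding A2 by simp
  finally have sb: "\<sigma> \<beta> = c ^ 2 * of_real B" using b_pos by simp
  have "\<sigma> (el u v w) = conj_val c u v w" for u v w
    unfolding el_def conj_val_def using alpha_in_K beta_in_K is_subfield_of_rat[OF K_subfield]
    by (simp add: embedding_add[OF F] embedding_mult[OF F] embedding_of_rat[OF F]
        subfield_add[OF K_subfield] subfield_mult[OF K_subfield] sa sb)
  then have "\<sigma> x = conj_emb c x" if "x \<in> K" for x
    using that K_eq conj_emb_el by auto
  moreover have "\<sigma> \<in> extensional K" using s by (simp add: embeddings_def)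
  ultimately have "\<sigma> = conj_emb c"
    by (intro extensionalityI[of _ K]) (simp_all add: conj_emb_def)
  then show "\<sigma> \<in> conj_emb ` {c. c ^ 3 = 1}" using \<open>c ^ 3 = 1\<close> by blast
qed (use conj_emb_embedding in auto)

lemma conj_emb_alpha: "conj_emb c \<alpha> = c * of_real A"
  using conj_emb_el[of c 0 1 0] by (simp add: el_def conj_val_def)

lemma conj_emb_beta: "conj_emb c \<beta> = c ^ 2 * of_real B"
  using conj_emb_el[of c 0 0 1] by (simp add: el_def conj_val_def)

lemma finite_embeddings: "finite (embeddings K)"
  unfolding embeddings_eq using finite_roots_unity[of 3, where ?'a = complex] by simp

lemma sum_embeddings: "(\<Sum>\<sigma>\<in>embeddings K. f \<sigma>) = (\<Sum>c | c ^ 3 = 1. f (conj_emb c))"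
proof -
  have "inj_on conj_emb {c. c ^ 3 = 1}"
  proof (rule inj_onI)
    fix c c' assume "conj_emb c = conj_emb c'"
    then have "conj_emb c \<alpha> = conj_emb c' \<alpha>" by simp
    then show "c = c'" using A_pos by (simp add: conj_emb_alpha)
  qed
  then show ?thesis unfolding embeddings_eq by (simp add: sum.reindex)
qed

section \<open>The projected lattice in real coordinates along \<alpha> and \<beta>\<close>

definition P :: "real \<Rightarrow> real \<Rightarrow> 'a minkowski" where
  "P s t = (\<lambda>\<sigma>. of_real s * minkowski_embed K \<alpha> \<sigma> + of_real t * minkowski_embed K \<beta> \<sigma>)"

lemma P_outside: "\<sigma> \<notin> embeddings K \<Longrightarrow> P s t \<sigma> = 0"
  by (simp add: P_def minkowski_embed_def)

lemma P_conj:
  "c ^ 3 = 1 \<Longrightarrow> P s t (conj_emb c) = of_real (s * A) * c + of_real (t * B) * c ^ 2"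
  by (simp add: P_def minkowski_embed_def conj_emb_embedding conj_emb_alpha conj_emb_beta ac_simps)

lemma cube_root_of_unity_cnj:
  assumes "(c :: complex) ^ 3 = 1"
  shows "c * cnj c = 1" "cnj c = c ^ 2"
proof -
  have "norm c ^ 3 = 1 ^ 3" using assms by (simp flip: norm_power)
  then have "norm c = 1" using power_eq_imp_eq_base[of "norm c" 3 1] by simp
  then show 1: "c * cnj c = 1" by (simp add: complex_norm_square[symmetric])
  have "c ^ 2 * (c * cnj c) = cnj c" using assms by (simp add: power2_eq_square power3_eq_cube flip: mult.assoc)
  then show "cnj c = c ^ 2" using 1 by simp
qed

text \<open>Orthogonality of 1, \<alpha> and \<beta>: at the embedding given by \<open>c\<close>
  they carry the factors 1, \<open>c\<close> and \<open>cnj c\<close>, so every mixed product sums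
  to 0.\<close>

lemma sum_cube_roots: "(\<Sum>c | (c :: complex) ^ 3 = 1. x + y * c + z * cnj c) = 3 * x"
proof -
  have s: "(\<Sum>c | (c :: complex) ^ 3 = 1. c) = 0" using sum_roots_unity[of 3] by simp
  have "(\<Sum>c | (c :: complex) ^ 3 = 1. cnj c) = cnj (\<Sum>c | (c :: complex) ^ 3 = 1. c)"
    by (rule cnj_sum[symmetric])
  then have "(\<Sum>c | (c :: complex) ^ 3 = 1. cnj c) = 0" unfolding s by simp
  then show ?thesis using s
    unfolding sum.distrib sum_distrib_left[symmetric] by (simp add: card_roots_unity_eq)
qed

lemma inner_P: "minkowski_inner K (P s t) (P s' t') = 3 * (s * s' * A ^ 2 + t * t' * B ^ 2)"
proof -
  have "(\<Sum>\<sigma>\<in>embeddings K. P s t \<sigma> * cnj (P s' t' \<sigma>))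
      = (\<Sum>c | c ^ 3 = 1. of_real (s * s' * A ^ 2 + t * t' * B ^ 2)
          + of_real (t * s' * A * B) * c + of_real (s * t' * A * B) * cnj c)"
    unfolding sum_embeddings
  proof (intro sum.cong refl)
    fix c :: complex assume "c \<in> {c. c ^ 3 = 1}"
    then have c: "c ^ 3 = 1" by simp
    note cc = cube_root_of_unity_cnj[OF c]
    have "P s t (conj_emb c) * cnj (P s' t' (conj_emb c))
      = of_real (s * s' * A ^ 2) * (c * cnj c) + of_real (t * t' * B ^ 2) * ((c * cnj c) * (c * cnj c))
        + of_real (t * s' * A * B) * (c * (c * cnj c)) + of_real (s * t' * A * B) * ((c * cnj c) * cnj c)"
      unfolding P_conj[OF c] by (simp add: power2_eq_square algebra_simps)
    then show "P s t (conj_emb c) * cnj (P s' t' (conj_emb c)) = of_real (s * s' * A ^ 2 + t * t' * B ^ 2)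
          + of_real (t * s' * A * B) * c + of_real (s * t' * A * B) * cnj c"
      unfolding cc(1) by simp
  qed
  also have "\<dots> = 3 * of_real (s * s' * A ^ 2 + t * t' * B ^ 2)" by (rule sum_cube_roots)
  finally show ?thesis unfolding minkowski_inner_def by simp
qed

lemma embed_conj: "c ^ 3 = 1 \<Longrightarrow> minkowski_embed K (el u v w) (conj_emb c) = conj_val c u v w"
  by (simp add: minkowski_embed_def conj_emb_embedding conj_emb_el)

lemma inner_embed_1: "minkowski_inner K (minkowski_embed K (el u v w)) (minkowski_embed K 1) = 3 * of_rat u"
proof -
  have "(\<Sum>\<sigma>\<in>embeddings K. minkowski_embed K (el u v w) \<sigma> * cnj (minkowski_embed K 1 \<sigma>))
      = (\<Sum>c | c ^ 3 = 1. of_real (of_rat u) + of_real (of_rat v * A) * c + of_real (of_rat w * B) * cnj c)"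
    unfolding sum_embeddings el_1
  proof (intro sum.cong refl)
    fix c :: complex assume "c \<in> {c. c ^ 3 = 1}"
    then have c: "c ^ 3 = 1" by simp
    show "minkowski_embed K (el u v w) (conj_emb c) * cnj (minkowski_embed K (el 1 0 0) (conj_emb c))
      = of_real (of_rat u) + of_real (of_rat v * A) * c + of_real (of_rat w * B) * cnj c"
      unfolding embed_conj[OF c] cube_root_of_unity_cnj(2)[OF c]
      by (simp add: conj_val_def of_real_of_rat ac_simps)
  qed
  also have "\<dots> = 3 * of_real (of_rat u)" by (rule sum_cube_roots)
  finally show ?thesis unfolding minkowski_inner_def by simp
qed

lemma proj_embed: "proj_perp_one K (minkowski_embed K (el u v w)) = P (of_rat v) (of_rat w)"
proof
  fix \<sigma>
  have 1: "minkowski_inner K (minkowski_embed K 1) (minkowski_embed K 1) = 3"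
    using inner_embed_1[of 1 0 0] by (simp flip: el_1)
  have *: "proj_perp_one K (minkowski_embed K (el u v w)) \<sigma>
     = minkowski_embed K (el u v w) \<sigma> - of_rat u * minkowski_embed K 1 \<sigma>"
    by (simp add: proj_perp_one_def Let_def inner_embed_1 1 of_real_of_rat)
  show "proj_perp_one K (minkowski_embed K (el u v w)) \<sigma> = P (of_rat v) (of_rat w) \<sigma>"
  proof (cases "\<sigma> \<in> embeddings K")
    case True
    then obtain c where c: "c ^ 3 = 1" "\<sigma> = conj_emb c" unfolding embeddings_eq by blast
    show ?thesis unfolding * unfolding c(2) P_conj[OF c(1)] el_1 embed_conj[OF c(1)]
      by (simp add: conj_val_def of_real_of_rat ac_simps)
  next
    case False
    then show ?thesis unfolding * by (simp add: P_outside minkowski_embed_def)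
  qed
qed

lemma perp_lattice_eq:
  "perp_lattice K = {P (of_rat v) (of_rat w) | u v w. algebraic_int (el u v w)}"
proof -
  have "ring_of_integers K = {el u v w | u v w. algebraic_int (el u v w)}"
    unfolding ring_of_integers_def using K_eq by blast
  then have "perp_lattice K
      = {proj_perp_one K (minkowski_embed K (el u v w)) | u v w. algebraic_int (el u v w)}"
    unfolding perp_lattice_def by auto
  then show ?thesis unfolding proj_embed .
qed

lemma P_comb: "of_real x * P s t \<sigma> + of_real y * P s' t' \<sigma> = P (x * s + y * s') (x * t + y * t') \<sigma>"
  by (simp add: P_def algebra_simps)

lemma P_eq_0:
  assumes "\<And>\<sigma>. P s t \<sigma> = 0"
  shows "s = 0 \<and> t = 0"
proof -
  have "P s t = (\<lambda>_. 0)" using assms by blast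
  then have "minkowski_inner K (P s t) (P s t) = 0" by (simp add: minkowski_inner_def)
  then have "(s * A) ^ 2 + (t * B) ^ 2 = 0" by (simp add: inner_P power2_eq_square algebra_simps)
  then show ?thesis using A_pos B_pos by (simp add: sum_power2_eq_zero_iff)
qed

lemma P_eq_iff: "P s t = P s' t' \<longleftrightarrow> s = s' \<and> t = t'"
proof
  assume e: "P s t = P s' t'"
  have "P (s - s') (t - t') \<sigma> = 0" for \<sigma>
    using fun_cong[OF e, of \<sigma>] P_comb[of 1 s t \<sigma> "-1" s' t'] by simp
  from P_eq_0[OF this] show "s = s' \<and> t = t'" by simp
qed simp

text \<open>One form of basis for both types: \<open>s = 0\<close>, \<open>t = 1\<close> in Type I,
  and \<open>s = 1 / 3\<close>, \<open>t = \<epsilon> / 3\<close> in Type II.\<close>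

lemma lattice_basis_P:
  assumes "perp_lattice K = {P (of_int m + of_int n * s) (of_int n * t) | m n. True}" "t \<noteq> 0"
  shows "lattice_basis (perp_lattice K) (P 1 0) (P s t)"
  unfolding lattice_basis_def
proof (intro conjI allI impI)
  have c: "(\<lambda>\<sigma>. of_int m * P 1 0 \<sigma> + of_int n * P s t \<sigma>) = P (of_int m + of_int n * s) (of_int n * t)" for m n
    using P_comb[of "of_int m" 1 0 _ "of_int n" s t] by (simp add: fun_eq_iff)
  show "perp_lattice K = {(\<lambda>\<sigma>. of_int m * P 1 0 \<sigma> + of_int n * P s t \<sigma>) | m n. True}"
    unfolding c by (rule assms(1))
  fix x y assume "\<forall>\<sigma>. of_real x * P 1 0 \<sigma> + of_real y * P s t \<sigma> = 0"
  then have "P (x * 1 + y * s) (x * 0 + y * t) \<sigma> = 0" for \<sigma> unfolding P_comb by blast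
  from P_eq_0[OF this] show "x = 0" "y = 0" using assms(2) by auto
qed

lemma perp_lattice_wild:
  assumes wild
  shows "perp_lattice K = {P (of_int m + of_int n * 0) (of_int n * 1) | m n. True}"
  unfolding perp_lattice_eq algebraic_int_wild_iff[OF assms]
proof (intro equalityI subsetI)
  fix x assume "x \<in> {P (of_rat v) (of_rat w) | u v w. u \<in> \<int> \<and> v \<in> \<int> \<and> w \<in> \<int>}"
  then obtain v w where x: "x = P (of_rat v) (of_rat w)" and "v \<in> \<int>" "w \<in> \<int>" by blast
  then obtain m n where "v = of_int m" "w = of_int n" by (elim Ints_cases)
  then have "x = P (of_int m + of_int n * 0) (of_int n * 1)" using x by simp
  then show "x \<in> {P (of_int m + of_int n * 0) (of_int n * 1) | m n. True}" by blast
next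
  fix x assume "x \<in> {P (of_int m + of_int n * 0) (of_int n * 1) | m n. True}"
  then obtain m n where "x = P (of_rat (of_int m)) (of_rat (of_int n))" by auto
  then show "x \<in> {P (of_rat v) (of_rat w) | u v w. u \<in> \<int> \<and> v \<in> \<int> \<and> w \<in> \<int>}"
    using Ints_0 Ints_of_int by blast
qed

lemma perp_lattice_tame:
  assumes e: "\<epsilon> = 1 \<or> \<epsilon> = (-1::int)" and cong: "[int a = \<epsilon> * int b] (mod 9)" and b: "\<not> 3 dvd int b"
  shows "perp_lattice K = {P (of_int m + of_int n * (1 / 3)) (of_int n * (of_int \<epsilon> / 3)) | m n. True}"
  unfolding perp_lattice_eq algebraic_int_tame_iff[OF assms]
proof (intro equalityI subsetI)
  fix x assume "x \<in> {P (of_rat v) (of_rat w) | u v w. \<exists>p q r :: int. u = of_int p / 3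
      \<and> v = of_int q + of_int (p * \<epsilon> * int b) / 3 \<and> w = of_int r + of_int (p * int b) / 3}"
  then obtain p q r :: int where x: "x = P (of_rat (of_int q + of_int (p * \<epsilon> * int b) / 3)) (of_rat (of_int r + of_int (p * int b) / 3))"
    by blast
  \<comment> \<open>Comparing the \<beta>-coordinates determines the coefficient of the second basis
    vector, and the \<alpha>-coordinates then give that of the first.\<close>
  have "x = P (of_int (q - \<epsilon> * r) + of_int (\<epsilon> * (3 * r + p * int b)) * (1 / 3))
      (of_int (\<epsilon> * (3 * r + p * int b)) * (of_int \<epsilon> / 3))"
    unfolding x P_eq_iff using e by (auto simp: of_rat_add of_rat_divide of_rat_mult of_rat_minus field_simps)
  then show "x \<in> {P (of_int m + of_int n * (1 / 3)) (of_int n * (of_int \<epsilon> / 3)) | m n. True}" by blast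
next
  fix x assume "x \<in> {P (of_int m + of_int n * (1 / 3)) (of_int n * (of_int \<epsilon> / 3)) | m n. True}"
  then obtain m n where x: "x = P (of_int m + of_int n * (1 / 3)) (of_int n * (of_int \<epsilon> / 3))" by blast
  obtain \<delta> j where d: "\<delta> = 1 \<or> \<delta> = -1" and bj: "int b = \<delta> + 3 * j" using not_3_dvd_cases[OF b] .
  \<comment> \<open>The equation \<open>3 * r + p * b = \<epsilon> * n\<close> has to be solved.
    Modulo 3 the inverse of \<open>b\<close> is \<delta>, which fixes \<open>p\<close>; then
    \<open>r\<close> is the exact quotient and \<open>q\<close> inverts
    \<open>m = q - \<epsilon> * r\<close>.\<close>
  define p r q where "p = \<delta> * \<epsilon> * n" and "r = - (j * \<delta> * \<epsilon> * n)" and "q = m + \<epsilon> * r"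
  have "3 * r + p * int b = \<epsilon> * n" "3 * q + p * \<epsilon> * int b = 3 * m + n"
    using d e unfolding p_def r_def q_def bj by (auto simp: algebra_simps)
  then have "real_of_int (3 * r + p * int b) = of_int (\<epsilon> * n)"
    "real_of_int (3 * q + p * \<epsilon> * int b) = of_int (3 * m + n)" by presburger+
  then have "x = P (of_rat (of_int q + of_int (p * \<epsilon> * int b) / 3)) (of_rat (of_int r + of_int (p * int b) / 3))"
    unfolding x P_eq_iff by (simp add: of_rat_add of_rat_divide of_rat_mult of_rat_minus field_simps)
  then show "x \<in> {P (of_rat v) (of_rat w) | u v w. \<exists>p q r :: int. u = of_int p / 3
      \<and> v = of_int q + of_int (p * \<epsilon> * int b) / 3 \<and> w = of_int r + of_int (p * int b) / 3}"
    by blast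
qed

end

section \<open>Shapes of pure cubic fields\<close>

context pure_cubic
begin

lemma minkowski_lattice: "minkowski_lattice K (perp_lattice K)"
  using finite_embeddings P_outside by unfold_locales (auto simp: perp_lattice_eq)

text \<open>The square root turns \<open>t\<close> into its absolute value, so the sign \<epsilon>
  of Type II disappears from the point.\<close>

lemma basis_point_P: "basis_point K (P 1 0) (P s t) = Complex s (\<bar>t\<bar> * root 3 (real a / real b))"
proof -
  have "(3 * (s ^ 2 * A ^ 2 + t ^ 2 * B ^ 2)) / (3 * A ^ 2) - s ^ 2 = (t * (B / A)) ^ 2"
    using A_pos by (simp add: field_simps)
  then have "sqrt ((3 * (s ^ 2 * A ^ 2 + t ^ 2 * B ^ 2)) / (3 * A ^ 2) - s ^ 2) = \<bar>t\<bar> * (B / A)"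
    using A_pos B_pos by (simp only: real_sqrt_abs abs_mult) simp
  then show ?thesis using A_pos
    by (simp add: basis_point_def Let_def inner_P B_div_A power2_eq_square)
qed

lemma shape_wild:
  assumes wild
  shows "\<i> * of_real (root 3 (real a / real b)) \<in> shape K" "rectangular_shape K"
proof -
  have L: "lattice_basis (perp_lattice K) (P 1 0) (P 0 1)"
    by (rule lattice_basis_P[OF perp_lattice_wild[OF assms]]) simp
  have "\<i> * of_real (root 3 (real a / real b)) = basis_point K (P 1 0) (P 0 1)"
    unfolding basis_point_P by (simp add: complex_eq_iff)
  then show "\<i> * of_real (root 3 (real a / real b)) \<in> shape K"
    using basis_point_in_shape[OF minkowski_lattice L] by simp
  show "rectangular_shape K"
    unfolding rectangular_shape_def using L inner_P[of 1 0 0 1] by auto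
qed

lemma shape_tame:
  assumes "\<not> wild"
  shows "(1 + \<i> * of_real (root 3 (real a / real b))) / 3 \<in> shape K"
proof -
  obtain \<epsilon> :: int where e: "\<epsilon> = 1 \<or> \<epsilon> = -1" "[int a = \<epsilon> * int b] (mod 9)" "\<not> 3 dvd int b"
    using not_wild_sign[OF assms] .
  have L: "lattice_basis (perp_lattice K) (P 1 0) (P (1 / 3) (of_int \<epsilon> / 3))"
    by (rule lattice_basis_P[OF perp_lattice_tame[OF e]]) (use e in auto)
  have "(1 + \<i> * of_real (root 3 (real a / real b))) / 3 = basis_point K (P 1 0) (P (1 / 3) (of_int \<epsilon> / 3))"
    unfolding basis_point_P using e(1) by (auto simp: complex_eq_iff)
  then show ?thesis using basis_point_in_shape[OF minkowski_lattice L] by simp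
qed

text \<open>As \<open>A ^ 2 = b * B\<close> and \<open>B ^ 2 = a * A\<close>, a relation would make
  \<open>B / A\<close> rational, although its cube is \<open>a / b\<close>.\<close>

lemma squares_lin_indep:
  assumes "of_rat x * A ^ 2 + of_rat y * B ^ 2 = 0"
  shows "x = 0 \<and> y = 0"
proof (cases "x = 0")
  case True
  then show ?thesis using assms B_pos by simp
next
  case False
  define q where "q = - (y * of_nat a) / (x * of_nat b)"
  have nz: "x * of_nat b \<noteq> 0" using False b_pos by simp
  have "of_rat (x * of_nat b) * B = - (of_rat (y * of_nat a) * A)"
    using assms unfolding A2 B2 by (simp add: of_rat_mult algebra_simps)
  then have "of_rat (x * of_nat b) * B = of_rat (x * of_nat b) * (of_rat q * A)"
    using nz by (simp add: q_def flip: of_rat_mult mult.assoc) (simp add: of_rat_minus)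
  then have "B = of_rat q * A" using nz by (simp only: mult_cancel_left of_rat_eq_0_iff) simp
  then have "B ^ 3 = of_rat (q ^ 3) * A ^ 3" by (simp add: power_mult_distrib of_rat_power)
  then have "of_rat (of_nat (a ^ 2 * b)) = (of_rat (q ^ 3 * of_nat (a * b ^ 2)) :: real)"
    unfolding A_cube B_cube by (simp only: of_rat_mult of_rat_of_nat_eq)
  then have "of_nat (a ^ 2 * b) = q ^ 3 * of_nat (a * b ^ 2)" by (simp only: of_rat_eq_iff)
  then have "of_nat a * 1 ^ 3 = of_nat b * q ^ 3"
    using a_pos b_pos by (simp add: power2_eq_square)
  then show ?thesis using ratio_not_cube[of 1 q] by simp
qed

lemma squares_eq_iff:
  assumes "of_rat x * A ^ 2 + of_rat y * B ^ 2 = of_rat x' * A ^ 2 + of_rat y' * B ^ 2"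
  shows "x = x' \<and> y = y'"
proof -
  have "of_rat (x - x') * A ^ 2 + of_rat (y - y') * B ^ 2 = 0"
    using assms by (simp add: of_rat_diff algebra_simps)
  from squares_lin_indep[OF this] show ?thesis by simp
qed

text \<open>Since \<open>(B / A)\<^sup>2\<close> is irrational, a symmetry preserves both squares in
  \<open>s\<^sup>2 A\<^sup>2 + t\<^sup>2 B\<^sup>2\<close> separately, and the lattice does not contain the reflected basis vectors.\<close>

lemma no_extra_symmetry_tame:
  assumes "\<not> wild"
  shows "no_extra_symmetry K"
  unfolding no_extra_symmetry_def
proof (intro allI impI)
  fix \<phi> assume sym: "lattice_symmetry K \<phi>"
  obtain \<epsilon> :: int where e: "\<epsilon> = 1 \<or> \<epsilon> = -1" "[int a = \<epsilon> * int b] (mod 9)" "\<not> 3 dvd int b"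
    using not_wild_sign[OF assms] .
  note L = perp_lattice_tame[OF e]
  define Q where "Q m n = P (of_int m + of_int n * (1 / 3)) (of_int n * (of_int \<epsilon> / 3))" for m n :: int
  have LQ: "perp_lattice K = {Q m n | m n. True}" unfolding Q_def by (rule L)
  have Q_in: "Q m n \<in> perp_lattice K" for m n unfolding LQ by blast
  have pres: "minkowski_inner K (\<phi> v) (\<phi> w) = minkowski_inner K v w"
    if "v \<in> perp_lattice K" "w \<in> perp_lattice K" for v w
    using sym that unfolding lattice_symmetry_def by blast
  have ex: "\<exists>m n. \<phi> v = Q m n" if "v \<in> perp_lattice K" for v
  proof -
    have "\<phi> v \<in> perp_lattice K" using sym that unfolding lattice_symmetry_def by (blast dest: bij_betwE)
    then show ?thesis unfolding LQ by blast
  qed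
  have ee: "real_of_int \<epsilon> * of_int \<epsilon> = 1" using e(1) by auto
  have inner_Q: "minkowski_inner K (Q m n) (Q m' n')
      = (of_rat (of_int ((3 * m + n) * (3 * m' + n'))) * A ^ 2 + of_rat (of_int (n * n')) * B ^ 2) / 3"
    for m n m' n'
  proof -
    have "of_int n * (of_int \<epsilon> / 3) * (of_int n' * (of_int \<epsilon> / 3)) = of_int n * of_int n' * (real_of_int \<epsilon> * of_int \<epsilon>) / 9"
      by simp
    also have "\<dots> = of_int (n * n') / (9 :: real)" unfolding ee by simp
    finally have n: "of_int n * (of_int \<epsilon> / 3) * (of_int n' * (of_int \<epsilon> / 3)) = of_int (n * n') / (9 :: real)" .
    show ?thesis unfolding Q_def inner_P n of_rat_of_int_eq by (simp add: field_simps)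
  qed
  have Q_pres: "(3 * m1 + n1) * (3 * m2 + n2) = (3 * k1 + l1) * (3 * k2 + l2) \<and> n1 * n2 = l1 * l2"
    if "\<phi> (Q k1 l1) = Q m1 n1" "\<phi> (Q k2 l2) = Q m2 n2" for k1 l1 k2 l2 m1 n1 m2 n2
  proof -
    have "minkowski_inner K (Q m1 n1) (Q m2 n2) = minkowski_inner K (Q k1 l1) (Q k2 l2)"
      using pres[OF Q_in Q_in, of k1 l1 k2 l2] that by simp
    then have "of_rat (of_int ((3 * m1 + n1) * (3 * m2 + n2))) * A ^ 2 + of_rat (of_int (n1 * n2)) * B ^ 2
      = of_rat (of_int ((3 * k1 + l1) * (3 * k2 + l2))) * A ^ 2 + of_rat (of_int (l1 * l2)) * B ^ 2"
      unfolding inner_Q by simp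
    from squares_eq_iff[OF this] show ?thesis by (simp only: of_int_eq_iff)
  qed
  obtain m n where 0: "\<phi> (Q 1 0) = Q m n" using ex[OF Q_in] by blast
  obtain m' n' where 1: "\<phi> (Q 0 1) = Q m' n'" using ex[OF Q_in] by blast
  have n: "n = 0" using Q_pres[OF 0 0] by simp
  then have "m * m = 1" using Q_pres[OF 0 0] by simp
  then have m: "m = 1 \<or> m = -1" unfolding zmult_eq_1_iff by blast
  have "n' * n' = 1" "(3 * m' + n') * (3 * m' + n') = 1" using Q_pres[OF 1 1] by simp_all
  then have "n' = 1 \<or> n' = -1" "3 * m' + n' = 1 \<or> 3 * m' + n' = -1" unfolding zmult_eq_1_iff by blast+
  \<comment> \<open>A reflection would need \<open>3 * m'\<close> equal to 2 or -2; this is where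
    the factor 1/3 in the basis excludes it.\<close>
  then have m': "m' = 0" by presburger
  \<comment> \<open>The inner product of the two basis vectors is nonzero, so their signs are tied
    together.\<close>
  have "n' = m" using Q_pres[OF 0 1] m unfolding n m' by auto
  \<comment> \<open>Each image is pinned down by its inner products with the images of the two basis
    vectors.\<close>
  have "\<phi> (Q k l) = Q (m * k) (m * l)" for k l
  proof -
    obtain i j where ij: "\<phi> (Q k l) = Q i j" using ex[OF Q_in] by blast
    have "3 * i + j = m * (3 * k + l)" using Q_pres[OF ij 0] m unfolding n by auto
    moreover have "j = m * l" using Q_pres[OF ij 1] m unfolding \<open>n' = m\<close> by auto
    ultimately show ?thesis using ij by (simp add: algebra_simps)
  qed
  moreover have "Q (m * k) (m * l) = (\<lambda>\<sigma>. of_int m * Q k l \<sigma>)" for k l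
    by (simp add: Q_def P_def fun_eq_iff algebra_simps)
  ultimately have phi: "\<phi> (Q k l) = (\<lambda>\<sigma>. of_int m * Q k l \<sigma>)" for k l by simp
  from m show "(\<forall>v\<in>perp_lattice K. \<phi> v = v) \<or> (\<forall>v\<in>perp_lattice K. \<phi> v = (\<lambda>\<sigma>. - v \<sigma>))"
  proof
    assume "m = 1"
    then have "\<forall>v\<in>perp_lattice K. \<phi> v = v" unfolding LQ by (auto simp: phi)
    then show ?thesis ..
  next
    assume "m = -1"
    then have "\<forall>v\<in>perp_lattice K. \<phi> v = (\<lambda>\<sigma>. - v \<sigma>)" unfolding LQ by (auto simp: phi)
    then show ?thesis ..
  qed
qed

section \<open>Uniqueness of the pair\<close>

lemma el_cube:
  "el x y z ^ 3 = el (x ^ 3 + of_nat (a * b ^ 2) * y ^ 3 + of_nat (a ^ 2 * b) * z ^ 3 + 6 * of_nat (a * b) * x * y * z)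
    (3 * (x ^ 2 * y + of_nat a * x * z ^ 2 + of_nat (a * b) * y ^ 2 * z))
    (3 * (x ^ 2 * z + of_nat b * x * y ^ 2 + of_nat (a * b) * y * z ^ 2))"
  unfolding power3_eq_cube[of "el x y z"] el_mult el_eq_iff
  by (simp add: power2_eq_square power3_eq_cube algebra_simps)

text \<open>An element with rational cube is a rational multiple of 1, \<alpha> or \<beta>:
  eliminating between the two vanishing coordinates gives
  \<open>x * (a * z ^ 3 - b * y ^ 3) = 0\<close>, and \<open>a / b\<close> is not a cube.\<close>

lemma rational_cube_cases:
  assumes "el x y z ^ 3 = of_nat m"
  shows "of_nat m = x ^ 3 \<or> of_nat m = y ^ 3 * of_nat (a * b ^ 2) \<or> of_nat m = z ^ 3 * of_nat (a ^ 2 * b)"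
proof -
  have "el x y z ^ 3 = el (of_nat m) 0 0" using assms by (simp add: el_def)
  then have m: "x ^ 3 + of_nat (a * b ^ 2) * y ^ 3 + of_nat (a ^ 2 * b) * z ^ 3 + 6 * of_nat (a * b) * x * y * z = of_nat m"
    and y: "x ^ 2 * y + of_nat a * x * z ^ 2 + of_nat (a * b) * y ^ 2 * z = 0"
    and z: "x ^ 2 * z + of_nat b * x * y ^ 2 + of_nat (a * b) * y * z ^ 2 = 0"
    unfolding el_cube el_eq_iff by auto
  have "x * (of_nat a * z ^ 3 - of_nat b * y ^ 3)
      = (x ^ 2 * y + of_nat a * x * z ^ 2 + of_nat (a * b) * y ^ 2 * z) * z
        - (x ^ 2 * z + of_nat b * x * y ^ 2 + of_nat (a * b) * y * z ^ 2) * y"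
    by (simp add: power2_eq_square power3_eq_cube algebra_simps)
  also have "\<dots> = 0" unfolding y z by simp
  finally have "x = 0 \<or> of_nat a * z ^ 3 = of_nat b * y ^ 3" by simp
  then consider "x = 0" | "y = 0" "z = 0" using ratio_not_cube[of z y] by blast
  then show ?thesis
  proof cases
    case 1
    then have "y = 0 \<or> z = 0" using y a_pos b_pos by simp
    then show ?thesis using m 1 by (auto simp: ac_simps)
  next
    case 2
    then show ?thesis using m by simp
  qed
qed

text \<open>A generator with cube \<open>a' * b' ^ 2\<close> is a multiple of 1, \<alpha> or
  \<beta>, which gives the pairs \<open>(1, 1)\<close>, \<open>(a, b)\<close> and
  \<open>(b, a)\<close>. The condition \<open>b' < a'\<close> rejects the first and the
  last.\<close>

lemma is_pure_cubic_pair_iff: "is_pure_cubic_pair K p \<longleftrightarrow> p = (a, b)"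
proof
  assume "p = (a, b)"
  then show "is_pure_cubic_pair K p"
    using b_pos b_less_a cop sqf_a sqf_b alpha_cube K_hull
    by (auto simp: is_pure_cubic_pair_def adjoins_cube_root_def)
next
  assume "is_pure_cubic_pair K p"
  then obtain a' b' \<theta> where p: "p = (a', b')" and ab': "0 < b'" "b' < a'" "coprime a' b'" "squarefree a'" "squarefree b'"
    and t: "\<theta> ^ 3 = of_nat (a' * b' ^ 2)" "K = is_subfield hull {\<theta>}"
    by (auto simp: is_pure_cubic_pair_def adjoins_cube_root_def)
  have "\<theta> \<in> K" unfolding t(2) by (simp add: hull_inc)
  then obtain x y z where "\<theta> = el x y z" using K_eq by blast
  then have "el x y z ^ 3 = of_nat (a' * b' ^ 2)" using t(1) by simp
  from rational_cube_cases[OF this] show "p = (a, b)"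
  proof (elim disjE)
    assume "of_nat (a' * b' ^ 2) = x ^ 3"
    then have "of_nat (a' * b' ^ 2) = x ^ 3 * of_nat (1 * 1 ^ 2)" by simp
    then have "a' = 1 \<and> b' = 1" using ab' by (intro squarefree_pair_unique) auto
    then show ?thesis using ab' by simp
  next
    assume "of_nat (a' * b' ^ 2) = y ^ 3 * of_nat (a * b ^ 2)"
    then have "a' = a \<and> b' = b" using ab' sqf_a sqf_b cop by (intro squarefree_pair_unique)
    then show ?thesis using p by simp
  next
    assume "of_nat (a' * b' ^ 2) = z ^ 3 * of_nat (a ^ 2 * b)"
    then have "of_nat (a' * b' ^ 2) = z ^ 3 * of_nat (b * a ^ 2)" by (simp only: mult.commute)
    then have "a' = b \<and> b' = a" using ab' sqf_a sqf_b cop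
      by (intro squarefree_pair_unique) (auto simp: coprime_commute)
    then show ?thesis using ab' b_less_a by simp
  qed
qed

lemma pure_cubic_pair_eq: "pure_cubic_pair K = (a, b)"
  unfolding pure_cubic_pair_def is_pure_cubic_pair_iff by simp

lemma ratio_eq: "ratio K = real a / real b"
  by (simp add: ratio_def pure_cubic_pair_eq)

lemma type_II_iff: "type_II K \<longleftrightarrow> \<not> wild"
  by (auto simp: type_II_def pure_cubic_pair_eq wild_def cong_def)

lemma root_ratio_gt_1: "root 3 (real a / real b) > 1"
  using b_pos b_less_a by simp

end

section \<open>Existence of a normalised generator\<close>

lemma subfield_hull_eqI:
  assumes "x \<in> is_subfield hull {y}" "y \<in> is_subfield hull {x}"
  shows "is_subfield hull {x} = is_subfield hull {y}"
  using assms by (intro equalityI hull_minimal is_subfield_hull) auto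

lemma subfield_of_nat:
  fixes F :: "'a::field_char_0 set"
  assumes "is_subfield F"
  shows "of_nat n \<in> F"
  using is_subfield_of_rat[OF assms, of "of_nat n"] by simp

lemma subfield_divide: "is_subfield F \<Longrightarrow> x \<in> F \<Longrightarrow> y \<in> F \<Longrightarrow> x / y \<in> F"
  unfolding divide_inverse by (intro subfield_mult subfield_inverse)

lemma pure_cubic_exists:
  fixes K :: "'a::field_char_0 set"
  assumes "pure_cubic_field K"
  shows "\<exists>a b \<alpha>. pure_cubic K a b \<alpha>"
proof -
  obtain m \<theta> where m: "m > 0" "\<nexists>n. m = n ^ 3" and t: "\<theta> ^ 3 = of_nat m" and K: "K = is_subfield hull {\<theta>}"
    using assms unfolding pure_cubic_field_def adjoins_cube_root_def by blast
  obtain c a b where mabc: "m = c ^ 3 * (a * b ^ 2)" and ab: "squarefree a" "squarefree b" "coprime a b"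
    using squarefree_pair_exists[OF m(1)] by blast
  have pos: "a > 0" "b > 0" "c > 0" using m(1) mabc by (auto intro!: Nat.gr0I)
  define \<eta> where "\<eta> = \<theta> / of_nat c"
  have eta: "\<eta> ^ 3 = of_nat (a * b ^ 2)" using pos t by (simp add: \<eta>_def power_divide mabc)
  have in_hull: "x \<in> is_subfield hull {x :: 'a}" for x by (simp add: hull_inc)
  have "\<theta> = \<eta> * of_nat c" using pos by (simp add: \<eta>_def)
  then have "\<theta> \<in> is_subfield hull {\<eta>}"
    using in_hull[of \<eta>] by (simp only: subfield_mult subfield_of_nat is_subfield_hull)
  moreover have "\<eta> \<in> is_subfield hull {\<theta>}"
    unfolding \<eta>_def by (intro subfield_divide subfield_of_nat is_subfield_hull in_hull)
  ultimately have K': "K = is_subfield hull {\<eta>}" unfolding K by (rule subfield_hull_eqI)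
  have "a \<noteq> b"
  proof
    assume "a = b"
    then have "a = 1" "b = 1" using ab(3) by auto
    then have "m = c ^ 3" using mabc by simp
    then show False using m(2) by blast
  qed
  then consider "b < a" | "a < b" by linarith
  then show ?thesis
  proof cases
    case 1
    then have "pure_cubic K a b \<eta>" using ab eta K' by unfold_locales
    then show ?thesis by blast
  next
    case 2
    \<comment> \<open>If the factors come in the wrong order, the companion root
      \<open>\<eta> ^ 2 / b\<close> generates the same field and has cube
      \<open>b * a ^ 2\<close>.\<close>
    define \<alpha> where "\<alpha> = \<eta> * \<eta> / of_nat b"
    have "\<alpha> ^ 3 = \<eta> ^ 3 * \<eta> ^ 3 / of_nat b ^ 3" by (simp add: \<alpha>_def power_divide power_mult_distrib)
    also have "\<dots> = of_nat (b * a ^ 2)"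
      unfolding eta using pos by (simp add: field_simps power2_eq_square power3_eq_cube)
    finally have alpha: "\<alpha> ^ 3 = of_nat (b * a ^ 2)" .
    have "\<alpha> * \<alpha> = \<eta> * \<eta> ^ 3 / of_nat b ^ 2"
      by (simp add: \<alpha>_def power2_eq_square power3_eq_cube)
    also have "\<dots> = of_nat a * \<eta>" unfolding eta using pos by (simp add: field_simps)
    finally have "\<eta> = \<alpha> * \<alpha> / of_nat a" using pos by simp
    also have "\<dots> \<in> is_subfield hull {\<alpha>}"
      by (intro subfield_divide subfield_mult subfield_of_nat is_subfield_hull in_hull)
    finally have "\<eta> \<in> is_subfield hull {\<alpha>}" .
    moreover have "\<alpha> \<in> is_subfield hull {\<eta>}"
      unfolding \<alpha>_def by (intro subfield_divide subfield_mult subfield_of_nat is_subfield_hull in_hull)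
    ultimately have "K = is_subfield hull {\<alpha>}" unfolding K' by (rule subfield_hull_eqI)
    then have "pure_cubic K b a \<alpha>" using ab 2 alpha by unfold_locales (simp_all add: coprime_commute)
    then show ?thesis by blast
  qed
qed

theorem theoremA:
  fixes K :: "'a::field_char_0 set"
  assumes "pure_cubic_field K"
  shows "(type_I K \<longrightarrow>
            \<i> * of_real (root 3 (ratio K)) \<in> shape K \<and>
            \<i> * of_real (root 3 (ratio K)) \<in> fund_domain \<and>
            Re (\<i> * of_real (root 3 (ratio K))) = 0 \<and>
            rectangular_shape K) \<and>
         (type_II K \<longrightarrow>
            (1 + \<i> * of_real (root 3 (ratio K))) / 3 \<in> shape K \<and>
            Re ((1 + \<i> * of_real (root 3 (ratio K))) / 3) = 1 / 3 \<and>
            Im ((1 + \<i> * of_real (root 3 (ratio K))) / 3) > 1 / 3 \<and>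
            no_extra_symmetry K)"
proof -
  obtain a b \<alpha> where "pure_cubic K a b \<alpha>" using pure_cubic_exists[OF assms] by blast
  then interpret pure_cubic K a b \<alpha> .
  define r where "r = root 3 (real a / real b)"
  have r: "r > 1" unfolding r_def by (rule root_ratio_gt_1)
  have R: "root 3 (ratio K) = r" by (simp add: ratio_eq r_def)
  have "\<i> * of_real r \<in> fund_domain" using r by (simp add: fund_domain_def one_le_power)
  then show ?thesis
    unfolding R type_I_def type_II_iff
    using shape_wild shape_tame no_extra_symmetry_tame r by (simp add: r_def)
qed

end
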